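(* Let $X^{L}$ be a real-valued Lamperti stable Lévy process with characteristics $(\alpha,f,\sigma,\theta)$, and let $\Psi_L$ denote its characteristic exponent, $E[e^{i\lambda X^L_t}]=e^{-t\Psi_L(\lambda)}$. Put $\beta=f(1)$, $\rho=f(-1)$, $c_+=\sigma(\{1\})$, $c_-=\sigma(\{-1\})$. (i) If $\alpha\in(0,1)\cup(1,2)$, then for all $\lambda\in\mathbb{R}$ $$\Psi_L(\lambda)=i\lambda\tilde\theta-c_+\Gamma(-\alpha)\big((-i\lambda+1-\beta)_\alpha-(1-\beta)_\alpha\big)-c_-\Gamma(-\alpha)\big((i\lambda+1-\rho)_\alpha-(1-\rho)_\alpha\big).$$ (ii) If $\alpha=1$, then for all $\lambda\in\mathbb{R}$ $$\Psi_L(\lambda)=i\lambda\tilde\theta-c_+\big((-i\lambda+1-\beta)\psi(-i\lambda+2-\beta)-(1-\beta)\psi(2-\beta)\big)-c_-\big((i\lambda+1-\rho)\psi(i\lambda+2-\rho)-(1-\rho)\psi(2-\rho)\big).$$ Here $$\tilde\theta=\begin{cases}-\mathbf{d} & \text{if }\alpha\in(0,1),\\ \theta-\big(c_+\tilde a_\beta-c_-\tilde b_\rho+(c_+-c_-)(1-\mathcal{C})\big) & \text{if }\alpha=1,\\ \theta-\Big(c_+\tilde a_\beta-c_-\tilde b_\rho+\dfrac{c_+-c_-}{\alpha-1}\Big) & \text{if }\alpha\in(1,2),\end{cases}$$ where $\mathcal{C}$ is the Euler constant, $\psi$ is the Digamma function, $\mathbf{d}$ is the drift coefficient of $X^L$,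 and $$\tilde a_\beta=\int_0^1\frac{xe^{-x}(1-e^{-(\alpha-\beta)x})}{(1-e^{-x})^{\alpha+1}}dx+\int_0^1e^{-x}\frac{1-x-e^{-x}}{(1-e^{-x})^{\alpha+1}}dx+\int_1^\infty\frac{e^{-x}}{(1-e^{-x})^\alpha}dx,$$ $$\tilde b_\rho=\int_0^1\frac{xe^{-x}(1-e^{-(\alpha-\rho)x})}{(1-e^{-x})^{\alpha+1}}dx+\int_0^1e^{-x}\frac{1-x-e^{-x}}{(1-e^{-x})^{\alpha+1}}dx+\int_1^\infty\frac{e^{-x}}{(1-e^{-x})^\alpha}dx.$$
   Context: Let $\alpha\in(0,2)$, let $\sigma$ be a non-zero finite measure on $S^0=\{-1,1\}$, and let $f:S^0\to\mathbb{R}$ satisfy $\max(f(1),f(-1))<\alpha+1$. With $\beta=f(1)$, $\rho=f(-1)$, $c_\pm=\sigma(\{\pm1\})$, define the Lévy measure on $\mathbb{R}\setminus\{0\}$ $$\nu^{\alpha,f}_\sigma(dx)=\Big(\frac{c_+e^{\beta x}}{(e^x-1)^{\alpha+1}}1_{\{x>0\}}+\frac{c_-e^{-\rho x}}{(e^{-x}-1)^{\alpha+1}}1_{\{x<0\}}\Big)dx.$$ A real Lévy process $X^L$ (started at $0$) is Lamperti stable with characteristics $(\alpha,f,\sigma,\theta)$, $\theta\in\mathbb{R}$, if it has no Gaussian component and $E[e^{iyX^L_t}]=e^{-t\Psi(y)}$ with $$\Psi(y)=iy\theta+\int_{\mathbb{R}\setminus\{0\}}\big(1-e^{iyx}+iyx1_{\{|x|<1\}}\big)\nu^{\alpha,f}_\sigma(dx).$$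 When $\alpha\in(0,1)$ one has $\Psi(y)=-i\mathbf{d}y+\int(1-e^{iyx})\nu^{\alpha,f}_\sigma(dx)$ with drift coefficient $\mathbf{d}=-\theta-\int_{\{|x|\le1\}}x\,\nu^{\alpha,f}_\sigma(dx)$. The Pochhammer symbol is $(z)_\alpha=\Gamma(z+\alpha)/\Gamma(z)$ for $z\in\mathbb{C}$, where $1/\Gamma$ is understood as an entire function (equal to $0$ at the poles of $\Gamma$). The Digamma function is $\psi=\Gamma'/\Gamma$ and $\mathcal{C}=-\psi(1)$. *)

theory Defs
  imports "HOL-Probability.Probability"
begin

definition levy_process :: "'a measure \<Rightarrow> (real \<Rightarrow> 'a \<Rightarrow> real) \<Rightarrow> bool" where
  "levy_process M X \<longleftrightarrow>
     prob_space M \<and>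
     (\<forall>t\<ge>0. X t \<in> borel_measurable M) \<and>
     (AE \<omega> in M. X 0 \<omega> = 0) \<and>
     (\<forall>(t :: nat \<Rightarrow> real) n. 0 \<le> t 0 \<longrightarrow> mono t \<longrightarrow>
        prob_space.indep_vars M (\<lambda>_. borel) (\<lambda>i \<omega>. X (t (Suc i)) \<omega> - X (t i) \<omega>) {..<n}) \<and>
     (\<forall>s\<ge>0. \<forall>h\<ge>0. distr M borel (\<lambda>\<omega>. X (s + h) \<omega> - X s \<omega>) = distr M borel (X h)) \<and>
     (AE \<omega> in M.
        (\<forall>t\<ge>0. ((\<lambda>s. X s \<omega>) \<longlongrightarrow> X t \<omega>) (at_right t)) \<and>
        (\<forall>t>0. \<exists>l. ((\<lambda>s. X s \<omega>) \<longlongrightarrow> l) (at_left t)))"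

text \<open>Requiring the identity for all times \<open>t\<close> determines \<open>\<Psi>\<close> uniquely,
  without choosing a branch of the complex logarithm.\<close>

definition characteristic_exponent ::
    "'a measure \<Rightarrow> (real \<Rightarrow> 'a \<Rightarrow> real) \<Rightarrow> (real \<Rightarrow> complex) \<Rightarrow> bool" where
  "characteristic_exponent M X \<Psi> \<longleftrightarrow>
     (\<forall>t\<ge>0. \<forall>y. char (distr M borel (X t)) y = exp (- (complex_of_real t * \<Psi> y)))"

text \<open>The exponent with linear coefficient \<open>\<theta>\<close>, Gaussian variance \<open>q\<close> and Levy measure \<open>\<nu>\<close>.
  The sign conventions are those of \<open>E[exp (i y X\<^sub>t)] = exp (- t \<Psi>(y))\<close>, so the
  Brownian motion with linear drift \<open>-\<theta>\<close> has exponent \<open>i y \<theta> + q y\<^sup>2 / 2\<close>.\<close>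

definition levy_khintchine_exponent :: "real \<Rightarrow> real \<Rightarrow> real measure \<Rightarrow> real \<Rightarrow> complex" where
  "levy_khintchine_exponent \<theta> q \<nu> y =
     \<i> * y * \<theta> + of_real (q * y\<^sup>2 / 2)
     + (CLINT x : -{0} | \<nu>. 1 - iexp (y * x) + \<i> * y * x * indicator {x. \<bar>x\<bar> < 1} x)"

definition lamperti_levy_measure ::
    "real \<Rightarrow> (real \<Rightarrow> real) \<Rightarrow> real measure \<Rightarrow> real measure" where
  "lamperti_levy_measure \<alpha> f \<sigma> = density lborel (\<lambda>x. ennreal (
     if x > 0 then measure \<sigma> {1} * exp (f 1 * x) / (exp x - 1) powr (\<alpha> + 1)
     else if x < 0 then measure \<sigma> {-1} * exp (- (f (-1) * x)) / (exp (-x) - 1) powr (\<alpha> + 1)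
     else 0))"

text \<open>The second argument \<open>0\<close> below says that there is no Gaussian component.\<close>

definition lamperti_stable ::
    "'a measure \<Rightarrow> (real \<Rightarrow> 'a \<Rightarrow> real) \<Rightarrow> real \<Rightarrow> (real \<Rightarrow> real) \<Rightarrow> real measure \<Rightarrow> real \<Rightarrow> bool" where
  "lamperti_stable M X \<alpha> f \<sigma> \<theta> \<longleftrightarrow>
     levy_process M X \<and>
     characteristic_exponent M X
       (levy_khintchine_exponent \<theta> 0 (lamperti_levy_measure \<alpha> f \<sigma>))"

text \<open>Meaningful for \<open>\<alpha> < 1\<close> only: otherwise the integrand need not be integrable.\<close>

definition lamperti_drift ::
    "real \<Rightarrow> (real \<Rightarrow> real) \<Rightarrow> real measure \<Rightarrow> real \<Rightarrow> real" where
  "lamperti_drift \<alpha> f \<sigma> \<theta> = - \<theta> - (LINT x : {x. \<bar>x\<bar> \<le> 1} | lamperti_levy_measure \<alpha> f \<sigma>. x)"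

text \<open>\<open>rGamma\<close> is the entire function \<open>1/\<Gamma>\<close>. The library's \<open>pochhammer\<close> only covers
  natural-number indices.\<close>

definition pochhammer_real :: "complex \<Rightarrow> real \<Rightarrow> complex" where
  "pochhammer_real z \<alpha> = Gamma (z + of_real \<alpha>) * rGamma z"

text \<open>With \<open>\<kappa> = f 1\<close> this is the constant attached to the positive half-line (usually
  written \<open>a\<^sub>\<beta>\<close> with a tilde), with \<open>\<kappa> = f (-1)\<close> the one attached to the negative
  half-line (\<open>b\<^sub>\<rho>\<close> with a tilde); the two are given by the same formula.\<close>

definition lamperti_const :: "real \<Rightarrow> real \<Rightarrow> real" where
  "lamperti_const \<alpha> \<kappa> =
     (LINT x : {0<..<1} | lborel.
        x * exp (-x) * (1 - exp (- ((\<alpha> - \<kappa>) * x))) / (1 - exp (-x)) powr (\<alpha> + 1))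
     + (LINT x : {0<..<1} | lborel.
        exp (-x) * ((1 - x - exp (-x)) / (1 - exp (-x)) powr (\<alpha> + 1)))
     + (LINT x : {1<..} | lborel. exp (-x) / (1 - exp (-x)) powr \<alpha>)"

definition lamperti_theta ::
    "real \<Rightarrow> (real \<Rightarrow> real) \<Rightarrow> real measure \<Rightarrow> real \<Rightarrow> real" where
  "lamperti_theta \<alpha> f \<sigma> \<theta> =
     (let c\<^sub>p = measure \<sigma> {1}; c\<^sub>m = measure \<sigma> {-1};
          a = lamperti_const \<alpha> (f 1); b = lamperti_const \<alpha> (f (-1))
      in if \<alpha> < 1 then - lamperti_drift \<alpha> f \<sigma> \<theta>
         else if \<alpha> = 1 then \<theta> - (c\<^sub>p * a - c\<^sub>m * b + (c\<^sub>p - c\<^sub>m) * (1 - euler_mascheroni))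
         else \<theta> - (c\<^sub>p * a - c\<^sub>m * b + (c\<^sub>p - c\<^sub>m) / (\<alpha> - 1)))"

end

theory Submission imports Defs "HOL-Real_Asymp.Real_Asymp" begin

text \<open>
  The characteristic function at all times determines the exponent, so \<open>\<Psi>\<close> is the
  Levy-Khintchine integral, and the task is to evaluate that integral. Reflecting the negative
  half-line onto the positive one reduces it to two integrals over \<open>(0, \<infinity>)\<close>, which differ only
  in the parameter and in the sign of the frequency \<open>y\<close>. With \<open>w = 1 - exp(-x)\<close>,
  \<open>r = \<alpha> + 1 - \<kappa>\<close> and \<open>s = r - i y\<close>, the density is \<open>exp(-r x) w powr (-\<alpha> - 1)\<close>, and the
  integral of \<open>1 - exp(i y x)\<close> against it is formally
  \<open>B(r, -\<alpha>) - B(s, -\<alpha>)\<close> for the Beta function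
  \<open>B(s, b) = \<Gamma>(s) \<Gamma>(b) / \<Gamma>(s + b) = \<integral> exp(-s x) w powr (b - 1) dx\<close>: the Pochhammer symbols of
  the claim are \<open>B(s, -\<alpha>) / \<Gamma>(-\<alpha>)\<close>. Since \<open>-\<alpha> < 0\<close>, neither term converges by itself.

  The divergence at \<open>0\<close> is compensated by \<open>(r - s) exp(-x) w\<close> in place of the
  truncation \<open>i y x 1(x < 1)\<close>; the two compensators differ exactly by the integrand of the
  constants in the drift (\<open>lamperti_const_eq\<close>), and the compensated integral has a closed form.
  The numerator \<open>exp(-r x) - exp(-s x) + (r - s) exp(-x) w\<close> vanishes to second order at \<open>0\<close>,
  so one integration by parts without boundary terms (\<open>integral_by_parts_powr\<close>) raises the
  exponent of \<open>w\<close> from \<open>-\<alpha> - 1\<close> to \<open>-\<alpha>\<close> and leaves a combination of the integrals of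
  \<open>(exp(-x) - exp(-s x)) w powr (-\<alpha>)\<close> (\<open>compensated_integral_by_parts\<close>). For \<open>\<alpha> < 1\<close> such an
  integral is a difference of convergent Beta integrals, for \<open>\<alpha> > 1\<close> a second integration by
  parts makes it one, and for \<open>\<alpha> = 1\<close> it is the integral of Gauss, \<open>\<psi>(s) + C\<close>, where the Digamma
  function and the Euler constant come from. The ranges \<open>\<alpha> < 1\<close> and \<open>\<alpha> > 1\<close> thus lead to the same
  closed form, and their linear terms agree as well: for \<open>\<alpha> < 1\<close>, minus the drift coefficient
  equals the expression that defines \<open>\<theta>\<close> with a tilde for \<open>\<alpha> > 1\<close> (\<open>lamperti_theta_neq_1\<close>).

  The Beta integral for complex \<open>s\<close> is obtained without analytic continuation. Integration by
  parts gives the recurrence \<open>(s + b) B(s + 1, b) = s B(s, b)\<close>; moving \<open>s\<close> to \<open>s + n\<close> with it,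
  the integral becomes insensitive to \<open>s\<close>, and what remains are the products in Euler's limit
  formula for \<open>\<Gamma>\<close>.
\<close>

section \<open>Integration by parts against powers of 1 - exp(-x)\<close>

text \<open>
  The weight is kept as a real power with a coercion: the base lies in \<open>(0, 1)\<close>, so no branch has
  to be chosen, and real asymptotics apply to it directly.
\<close>
abbreviation w_powr :: "real \<Rightarrow> real \<Rightarrow> complex" where
  "w_powr p x \<equiv> complex_of_real ((1 - exp (-x)) powr p)"

lemma powr_one_minus_exp_bigo_at_0:
  "(\<lambda>x. w_powr p x) \<in> O[at_right 0](\<lambda>x. of_real (x powr p))"
proof -
  have "(\<lambda>x::real. (1 - exp (-x)) powr p) \<in> O[at_right 0](\<lambda>x. x powr p)"
    by real_asymp
  then show ?thesis by (simp only: landau_o.big.of_real_iff)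
qed

lemma powr_one_minus_exp_bigo_at_top:
  "(\<lambda>x. w_powr p x) \<in> O(\<lambda>x. 1)"
proof -
  have "(\<lambda>x::real. (1 - exp (-x)) powr p) \<in> O(\<lambda>x. 1)"
    by real_asymp
  then have "(\<lambda>x. w_powr p x) \<in> O(\<lambda>x. of_real 1)" by (simp only: landau_o.big.of_real_iff)
  then show ?thesis by simp
qed

text \<open>
  Up to a constant, \<open>g\<close> is dominated by \<open>x powr q * exp(-\<delta> x / 2)\<close>, the integrand of
  a Gamma integral; half of the decay rate is given up to absorb the power at infinity.
\<close>
lemma set_integrable_half_line:
  fixes g :: "real \<Rightarrow> complex"
  assumes cont: "continuous_on {0<..} g"
    and at_0: "g \<in> O[at_right 0](\<lambda>x. of_real (x powr q))" and q: "q > -1"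
    and at_top: "g \<in> O(\<lambda>x. of_real (exp (- (\<delta> * x))))" and \<delta>: "\<delta> > 0"
  shows "set_integrable lborel {0<..} g"
proof -
  define d where "d = (\<lambda>x::real. x powr q * exp (- (\<delta> / 2 * x)))"
  have d_pos: "d x > 0" if "x > 0" for x using that by (simp add: d_def)
  have d_cont: "continuous_on {0<..} d"
    unfolding d_def by (intro continuous_intros) auto
  have "complex_set_integrable lebesgue {0<..}
      (\<lambda>t. complex_of_real t powr (of_real (q + 1) - 1) / complex_of_real (exp (\<delta> / 2 * t)))"
    using q \<delta> by (intro absolutely_integrable_Gamma_integral) auto
  from absolutely_integrable_norm[OF this]
  have "set_integrable lebesgue {0<..} 
         (\<lambda>t. norm (complex_of_real t powr (of_real (q + 1) - 1) / complex_of_real (exp (\<delta> / 2 * t))))"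
    by (simp add: o_def)
  also have "?this \<longleftrightarrow> set_integrable lebesgue {0<..} d"
  proof (rule set_integrable_cong)
    fix t :: real assume "t \<in> {0<..}"
    then have "norm (complex_of_real t powr (complex_of_real (q + 1) - 1)) = t powr q"
      by (subst norm_powr_real_powr) auto
    then show "norm (complex_of_real t powr (complex_of_real (q + 1) - 1) / complex_of_real (exp (\<delta> / 2 * t))) = d t"
      unfolding d_def norm_divide norm_of_real exp_minus by (simp only: divide_inverse abs_exp_cancel)
  qed simp_all
  finally have "set_integrable lebesgue {0<..} d" .
  then have d_int: "set_integrable lborel {0<..} d"
    unfolding set_integrable_def
    by (subst (asm) integrable_completion)
       (use borel_measurable_continuous_on_indicator[OF _ d_cont] in auto)
  have "(\<lambda>x::real. x powr q) \<in> O[at_right 0](d)" "(\<lambda>x. exp (- (\<delta> * x))) \<in> O(d)"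
    using \<delta> q unfolding d_def by real_asymp+
  then have "g \<in> O[at_right 0](\<lambda>x. of_real (d x))" "g \<in> O(\<lambda>x. of_real (d x))"
    using at_0 at_top by (metis landau_o.big.of_real_iff landau_o.big_trans)+
  then obtain c1 c2 where c1: "\<forall>\<^sub>F x in at_right 0. norm (g x) \<le> c1 * norm (of_real (d x) :: complex)"
    and c2: "\<forall>\<^sub>F x in at_top. norm (g x) \<le> c2 * norm (of_real (d x) :: complex)"
    by (auto elim!: landau_o.bigE)
  from c1 obtain e where e: "e > 0" "\<And>x. 0 < x \<Longrightarrow> x < e \<Longrightarrow> norm (g x) \<le> c1 * \<bar>d x\<bar>"
    by (auto simp: eventually_at_right_field)
  from c2 obtain R where R: "\<And>x. x \<ge> R \<Longrightarrow> norm (g x) \<le> c2 * \<bar>d x\<bar>"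
    by (auto simp: eventually_at_top_linorder)
  have "compact ((\<lambda>x. norm (g x) / d x) ` {e..R})"
    using e(1) d_pos[THEN less_imp_neq]
    by (intro compact_continuous_image continuous_intros continuous_on_subset[OF cont]
        continuous_on_subset[OF d_cont] compact_Icc) force+
  then have "bounded ((\<lambda>x. norm (g x) / d x) ` {e..R})" by (rule compact_imp_bounded)
  then obtain c3 where "\<forall>y\<in>(\<lambda>x. norm (g x) / d x) ` {e..R}. norm y \<le> c3"
    unfolding bounded_iff by blast
  then have c3: "norm (norm (g x) / d x) \<le> c3" if "e \<le> x" "x \<le> R" for x
    using that by auto
  define c where "c = max c1 (max c2 c3)"
  have bound: "norm (g x) \<le> norm (c * d x)" if x: "x > 0" for x
  proof -
    have "norm (g x) \<le> c1 * d x \<or> norm (g x) \<le> c2 * d x \<or> norm (g x) \<le> c3 * d x"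
    proof (cases "x < e")
      case True
      then show ?thesis using e(2)[of x] d_pos[of x] x by auto
    next
      case ge: False
      show ?thesis
      proof (cases "x \<ge> R")
        case True then show ?thesis using R[of x] d_pos[of x] x by auto
      next
        case False
        then have "norm (g x) / d x \<le> c3" using c3[of x] ge d_pos[of x] x by auto
        then show ?thesis using d_pos[of x] x by (simp add: field_simps)
      qed
    qed
    moreover have "c1 * d x \<le> c * d x" "c2 * d x \<le> c * d x" "c3 * d x \<le> c * d x"
      using d_pos[OF x] by (auto simp: c_def intro!: mult_right_mono)
    ultimately have "norm (g x) \<le> c * d x" by linarith
    then show ?thesis by (simp add: abs_le_iff)
  qed
  show ?thesis
  proof (rule set_integrable_bound)
    show "set_integrable lborel {0<..} (\<lambda>x. c * d x)" using d_int by simp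
    show "set_borel_measurable lborel {0<..} g"
      unfolding set_borel_measurable_def
      using borel_measurable_continuous_on_indicator[OF _ cont] by simp
    show "AE x\<in>{0<..} in lborel. norm (g x) \<le> norm (c * d x)"
      using bound by auto
  qed
qed

lemma continuous_on_powr_one_minus_exp [continuous_intros]:
  "continuous_on {0<..} (\<lambda>x::real. w_powr p x)"
  by (intro continuous_intros) auto

lemma set_integrable_half_line_powr:
  fixes h :: "real \<Rightarrow> complex"
  assumes cont: "continuous_on {0<..} h"
    and at_0: "h \<in> O[at_right 0](\<lambda>x. of_real (x powr m))" and m: "m + p > -1"
    and at_top: "h \<in> O(\<lambda>x. of_real (exp (- (\<delta> * x))))" and \<delta>: "\<delta> > 0"
  shows "set_integrable lborel {0<..} (\<lambda>x. h x * w_powr p x)"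
proof (rule set_integrable_half_line)
  show "continuous_on {0<..} (\<lambda>x. h x * w_powr p x)"
    by (intro continuous_intros cont)
  show "(\<lambda>x. h x * w_powr p x) \<in> O[at_right 0](\<lambda>x. of_real (x powr (m + p)))"
    using landau_o.big.mult[OF at_0 powr_one_minus_exp_bigo_at_0] by (simp add: powr_add)
  show "(\<lambda>x. h x * w_powr p x) \<in> O(\<lambda>x. of_real (exp (- (\<delta> * x))))"
    using landau_o.big.mult[OF at_top powr_one_minus_exp_bigo_at_top[of p]] by simp
qed fact+

lemma tendsto_0_bigo:
  fixes h :: "'a \<Rightarrow> complex"
  assumes "h \<in> O[F](\<lambda>x. of_real (g x))" "(g \<longlongrightarrow> 0) F"
  shows "(h \<longlongrightarrow> 0) F"
proof -
  from assms(1) obtain c where c: "\<forall>\<^sub>F x in F. norm (h x) \<le> c * norm (of_real (g x) :: complex)"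
    by (auto elim!: landau_o.bigE)
  have "((\<lambda>x. c * \<bar>g x\<bar>) \<longlongrightarrow> 0) F"
    using assms(2) by (auto intro!: tendsto_eq_intros)
  then show ?thesis
    by (rule Lim_null_comparison[rotated]) (use c in simp)
qed

lemma half_line_FTC:
  fixes F f :: "real \<Rightarrow> complex"
  assumes deriv: "\<And>x. x > 0 \<Longrightarrow> (F has_vector_derivative f x) (at x)"
    and cont: "continuous_on {0<..} f"
    and int: "set_integrable lborel {0<..} f"
    and at_0: "(F \<longlongrightarrow> A) (at_right 0)" and at_top: "(F \<longlongrightarrow> B) at_top"
  shows "(CLINT x:{0<..}|lborel. f x) = B - A"
proof -
  have "(LBINT x=ereal 0..\<infinity>. f x) = B - A"
  proof (rule interval_integral_FTC_integrable)
    fix x :: real assume "ereal 0 < ereal x"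
    then have x: "x > 0" by simp
    show "(F has_vector_derivative f x) (at x)" by (rule deriv[OF x])
    show "isCont f x" using x cont by (simp add: continuous_on_eq_continuous_at)
  next
    have "einterval (ereal 0) \<infinity> = {0<..}" by (auto simp: einterval_def)
    then show "set_integrable lborel (einterval (ereal 0) \<infinity>) f" using int by simp
    show "((F \<circ> real_of_ereal) \<longlongrightarrow> A) (at_right (ereal 0))"
      using at_0 by (simp only: ereal_tendsto_simps)
    show "((F \<circ> real_of_ereal) \<longlongrightarrow> B) (at_left \<infinity>)"
      using at_top by (simp only: ereal_tendsto_simps)
  qed simp
  then show ?thesis by (simp add: interval_integral_to_infinity_eq)
qed

text \<open>
  The antiderivative is \<open>h w powr b\<close>, where \<open>exp(-x) = 1 - w\<close> turns the derivative
  \<open>b exp(-x) w powr (b - 1)\<close> of the power into one of \<open>w powr (b - 1)\<close> and one of \<open>w powr b\<close>.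
  The condition \<open>m + b > 0\<close> kills the boundary term at \<open>0\<close>; as \<open>b\<close> may be negative, a
  zero of \<open>h\<close> of order \<open>m\<close> takes the place of the convergence condition of the Beta integral.
\<close>
lemma integral_by_parts_powr:
  fixes h h' :: "real \<Rightarrow> complex"
  assumes deriv: "\<And>x. x > 0 \<Longrightarrow> (h has_vector_derivative h' x) (at x)"
    and cont': "continuous_on {0<..} h'"
    and at_0: "h \<in> O[at_right 0](\<lambda>x. of_real (x powr m))"
    and at_0': "h' \<in> O[at_right 0](\<lambda>x. of_real (x powr (m - 1)))"
    and at_top: "h \<in> O(\<lambda>x. of_real (exp (- (\<delta> * x))))"
    and at_top': "h' \<in> O(\<lambda>x. of_real (exp (- (\<delta> * x))))"
    and \<delta>: "\<delta> > 0" and mb: "m + b > 0"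
  shows "- of_real b * (CLINT x:{0<..}|lborel. h x * w_powr (b - 1) x) =
         (CLINT x:{0<..}|lborel. (h' x - of_real b * h x) * w_powr b x)"
proof -
  have cont: "continuous_on {0<..} h"
    using deriv by (intro continuous_at_imp_continuous_on)
      (auto intro: has_vector_derivative_continuous)
  define w where "w = (\<lambda>x::real. 1 - exp (-x))"
  have w_pos: "w x > 0" if "x > 0" for x using that by (simp add: w_def)
  define f where "f = (\<lambda>x. (h' x - of_real b * h x) * of_real (w x powr b)
                         + of_real b * (h x * of_real (w x powr (b - 1))))"
  have int1: "set_integrable lborel {0<..} (\<lambda>x. h x * of_real (w x powr (b - 1)))"
    unfolding w_def using mb by (intro set_integrable_half_line_powr[OF cont at_0 _ at_top \<delta>]) simp
  have int2: "set_integrable lborel {0<..} (\<lambda>x. h x * of_real (w x powr b))"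
    unfolding w_def using mb by (intro set_integrable_half_line_powr[OF cont at_0 _ at_top \<delta>]) simp
  have int3: "set_integrable lborel {0<..} (\<lambda>x. h' x * of_real (w x powr b))"
    unfolding w_def using mb by (intro set_integrable_half_line_powr[OF cont' at_0' _ at_top' \<delta>]) simp
  have int4: "set_integrable lborel {0<..} (\<lambda>x. (h' x - of_real b * h x) * of_real (w x powr b))"
    using set_integral_diff(1)[OF int3 set_integrable_mult_right[OF int2, of "of_real b"]]
    by (simp add: algebra_simps)
  have int1': "set_integrable lborel {0<..} (\<lambda>x. of_real b * (h x * of_real (w x powr (b - 1))))"
    using int1 by (intro set_integrable_mult_right) auto
  have int: "set_integrable lborel {0<..} f"
    unfolding f_def by (intro set_integral_add int4 int1')
  have "(CLINT x:{0<..}|lborel. f x) = 0 - 0"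
  proof (rule half_line_FTC)
    fix x :: real assume x: "x > 0"
    have "((\<lambda>x. h x * of_real (w x powr b)) has_vector_derivative
            (h x * of_real (b * w x powr (b - 1) * exp (-x)) + h' x * of_real (w x powr b))) (at x)"
    proof (rule has_vector_derivative_mult)
      have "((\<lambda>x. w x powr b) has_real_derivative b * w x powr (b - 1) * exp (-x)) (at x)"
        unfolding w_def using x by (auto intro!: derivative_eq_intros simp: powr_diff field_simps)
      then show "((\<lambda>x. complex_of_real (w x powr b)) has_vector_derivative
            of_real (b * w x powr (b - 1) * exp (-x))) (at x)"
        by (intro has_vector_derivative_of_real) (simp add: has_real_derivative_iff_has_vector_derivative)
    qed (use deriv x in auto)
    also have "h x * of_real (b * w x powr (b - 1) * exp (-x)) + h' x * of_real (w x powr b) = f x"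
    proof -
      have "w x powr (b - 1) * exp (-x) = w x powr (b - 1) - w x powr (b - 1) * w x"
        by (simp add: w_def algebra_simps)
      also have "w x powr (b - 1) * w x = w x powr b"
        using w_pos[OF x] by (simp add: powr_diff)
      finally have "w x powr (b - 1) * exp (-x) = w x powr (b - 1) - w x powr b" .
      then have "b * w x powr (b - 1) * exp (-x) = b * (w x powr (b - 1) - w x powr b)"
        by (simp add: mult.assoc)
      then show ?thesis by (simp only: f_def) (simp add: algebra_simps)
    qed
    finally show "((\<lambda>x. h x * of_real (w x powr b)) has_vector_derivative f x) (at x)" .
  next
    show "continuous_on {0<..} f"
      unfolding f_def w_def by (intro continuous_intros cont cont')
  next
    show "((\<lambda>x. h x * of_real (w x powr b)) \<longlongrightarrow> 0) (at_right 0)"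
    proof (rule tendsto_0_bigo)
      show "(\<lambda>x. h x * of_real (w x powr b)) \<in> O[at_right 0](\<lambda>x. of_real (x powr (m + b)))"
        using landau_o.big.mult[OF at_0 powr_one_minus_exp_bigo_at_0] by (simp add: powr_add w_def)
      show "((\<lambda>x. x powr (m + b)) \<longlongrightarrow> 0) (at_right 0)" using mb by real_asymp
    qed
    show "((\<lambda>x. h x * of_real (w x powr b)) \<longlongrightarrow> 0) at_top"
    proof (rule tendsto_0_bigo)
      show "(\<lambda>x. h x * of_real (w x powr b)) \<in> O(\<lambda>x. of_real (exp (- (\<delta> * x))))"
        using landau_o.big.mult[OF at_top powr_one_minus_exp_bigo_at_top[of b]] by (simp add: w_def)
      show "((\<lambda>x. exp (- (\<delta> * x))) \<longlongrightarrow> 0) at_top" using \<delta> by real_asymp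
    qed
  qed (rule int)
  also have "(CLINT x:{0<..}|lborel. f x) =
     (CLINT x:{0<..}|lborel. (h' x - of_real b * h x) * of_real (w x powr b)) +
     of_real b * (CLINT x:{0<..}|lborel. h x * of_real (w x powr (b - 1)))"
    unfolding f_def by (subst set_integral_add(2)[OF int4 int1']) simp
  finally show ?thesis by (simp add: w_def add_eq_0_iff algebra_simps)
qed

lemma bigo_cmult:
  fixes f g :: "real \<Rightarrow> complex"
  assumes "f \<in> O[F](g)" shows "(\<lambda>x. c * f x) \<in> O[F](g)"
  using assms by (cases "c = 0") auto

text \<open>
  These orders of vanishing determine the admissible \<open>m\<close> in the integration by parts for
  linear combinations of exponentials.
\<close>
lemma exp_minus_one_bigo:
  fixes z :: complex
  shows "(\<lambda>x. exp (z * of_real x) - 1) \<in> O[at_right 0](\<lambda>x. of_real (x powr 1))"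
  and "(\<lambda>x. exp (z * of_real x) - 1 - z * of_real x) \<in> O[at_right 0](\<lambda>x. of_real (x powr 2))"
proof -
  have ev: "\<forall>\<^sub>F x::real in at_right 0. x \<in> {0<..<1}"
    by (rule eventually_at_right_real) simp
  have b: "norm (exp (z * of_real x) - (\<Sum>k\<le>n. (z * of_real x) ^ k / fact k)) \<le> exp (norm z) * norm z ^ Suc n * norm (complex_of_real (x ^ Suc n))"
    if x: "x \<in> {0<..<1}" for x n
  proof -
    have "norm (exp (z * of_real x) - (\<Sum>k\<le>n. (z * of_real x) ^ k / fact k)) \<le> exp \<bar>Re (z * of_real x)\<bar> * norm (z * of_real x) ^ Suc n / fact n"
      by (rule Taylor_exp)
    also have "\<dots> \<le> exp \<bar>Re (z * of_real x)\<bar> * norm (z * of_real x) ^ Suc n / 1"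
      by (intro divide_left_mono) auto
    also have "\<dots> \<le> exp (norm z) * norm (z * of_real x) ^ Suc n / 1"
    proof -
      have "\<bar>Re (z * of_real x)\<bar> \<le> norm (z * of_real x)" by (rule abs_Re_le_cmod)
      also have "\<dots> \<le> norm z" using x by (simp add: norm_mult mult_left_le)
      finally show ?thesis by (intro divide_right_mono mult_right_mono) auto
    qed
    finally show ?thesis by (simp add: norm_mult power_mult_distrib norm_power mult_ac)
  qed
  show "(\<lambda>x. exp (z * of_real x) - 1) \<in> O[at_right 0](\<lambda>x. of_real (x powr 1))"
    by (rule bigoI, rule eventually_mono[OF ev]) (use b[where n = 0] in auto)
  show "(\<lambda>x. exp (z * of_real x) - 1 - z * of_real x) \<in> O[at_right 0](\<lambda>x. of_real (x powr 2))"
    by (rule bigoI, rule eventually_mono[OF ev])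
      (use b[where n = 1] in \<open>auto simp: power2_eq_square powr_numeral diff_diff_eq\<close>)
qed

lemma exp_bigo_at_top:
  fixes s :: complex
  assumes "\<delta> \<le> Re s"
  shows "(\<lambda>x. exp (- (s * of_real x))) \<in> O(\<lambda>x. of_real (exp (- (\<delta> * x))))"
  by (rule bigoI[where c = 1], rule eventually_mono[OF eventually_ge_at_top[of 0]])
     (use assms in \<open>auto simp: mult_right_mono\<close>)

lemma exp_bigo_at_0:
  fixes s :: complex
  shows "(\<lambda>x. exp (- (s * of_real x))) \<in> O[at_right 0](\<lambda>x. of_real (x powr 0))"
proof -
  have "((\<lambda>x::real. exp (- (s * of_real x))) \<longlongrightarrow> exp (- (s * of_real 0))) (at_right 0)"
    by (intro tendsto_intros)
  then have "(\<lambda>x::real. exp (- (s * of_real x))) \<in> O[at_right 0](\<lambda>x. 1)"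
    by (intro bigoI_tendsto[where c = 1]) auto
  also have "(\<lambda>x::real. 1) \<in> O[at_right 0](\<lambda>x. complex_of_real (x powr 0))"
    by (rule bigoI[where c = 1]) (auto simp: eventually_at_right_field intro!: exI[of _ 1])
  finally show ?thesis .
qed

section \<open>The Beta integral with complex exponent\<close>

text \<open>
  The substitution \<open>t = exp(-x)\<close> turns this into Euler's integral of
  \<open>t powr (s - 1) (1 - t) powr (b - 1)\<close> over \<open>(0, 1)\<close>.
\<close>
definition beta_integral :: "complex \<Rightarrow> real \<Rightarrow> complex" where
  "beta_integral s b = (CLINT x:{0<..}|lborel. exp (- (s * of_real x)) * w_powr (b - 1) x)"

lemma beta_integrable:
  assumes "Re s > 0" "b > 0"
  shows "set_integrable lborel {0<..} (\<lambda>x. exp (- (s * of_real x)) * w_powr (b - 1) x)"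
  by (rule set_integrable_half_line_powr[OF _ exp_bigo_at_0 _ exp_bigo_at_top[of "Re s"]])
     (use assms in \<open>auto intro!: continuous_intros\<close>)

lemma beta_integral_by_parts:
  assumes s: "Re s > 0" and b: "b > 0"
  shows "of_real b * beta_integral s b = (s + of_real b) * beta_integral s (b + 1)"
proof -
  have "- of_real b * (CLINT x:{0<..}|lborel. exp (- (s * of_real x)) * w_powr (b - 1) x) =
         (CLINT x:{0<..}|lborel. (- s * exp (- (s * of_real x)) - of_real b * exp (- (s * of_real x))) * w_powr b x)"
  proof (rule integral_by_parts_powr[where m = 0 and \<delta> = "Re s"])
    show "((\<lambda>x. exp (- (s * complex_of_real x))) has_vector_derivative - s * exp (- (s * of_real x))) (at x)" for x
      by (auto intro!: derivative_eq_intros has_vector_derivative_real_field)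
    have "(\<lambda>x. exp (- (s * of_real x))) \<in> O[at_right 0](\<lambda>x. of_real (x powr 0))"
      by (rule exp_bigo_at_0)
    also have "(\<lambda>x. complex_of_real (x powr 0)) \<in> O[at_right 0](\<lambda>x. of_real (x powr (0 - 1)))"
      unfolding landau_o.big.of_real_iff by real_asymp
    finally show "(\<lambda>x. - s * exp (- (s * of_real x))) \<in> O[at_right 0](\<lambda>x. of_real (x powr (0 - 1)))"
      by (cases "s = 0") auto
    show "(\<lambda>x. - s * exp (- (s * of_real x))) \<in> O(\<lambda>x. of_real (exp (- (Re s * x))))"
      using exp_bigo_at_top[of "Re s" s] by (cases "s = 0") auto
    show "(\<lambda>x. exp (- (s * of_real x))) \<in> O[at_right 0](\<lambda>x. of_real (x powr 0))"
      by (rule exp_bigo_at_0)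
    show "(\<lambda>x. exp (- (s * of_real x))) \<in> O(\<lambda>x. of_real (exp (- (Re s * x))))"
      by (rule exp_bigo_at_top) simp
  qed (use s b in \<open>auto intro!: continuous_intros\<close>)
  also have "\<dots> = (CLINT x:{0<..}|lborel. - (s + of_real b) * (exp (- (s * of_real x)) * w_powr (b + 1 - 1) x))"
    by (simp add: algebra_simps)
  also have "\<dots> = - (s + of_real b) * beta_integral s (b + 1)"
    unfolding beta_integral_def by (rule set_integral_mult_right)
  finally show ?thesis by (simp add: beta_integral_def add_eq_0_iff algebra_simps)
qed

text \<open>
  One factor \<open>w = 1 - exp(-x)\<close> is expanded.
\<close>
lemma beta_integral_split:
  assumes s: "Re s > 0" and b: "b > 0"
  shows "beta_integral s (b + 1) = beta_integral s b - beta_integral (s + 1) b"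
proof -
  have "beta_integral s (b + 1) = (CLINT x:{0<..}|lborel. 
      exp (- (s * of_real x)) * w_powr (b - 1) x
      - exp (- ((s + 1) * of_real x)) * w_powr (b - 1) x)"
    unfolding beta_integral_def
  proof (rule set_lebesgue_integral_cong)
    show "\<forall>x. x \<in> {0<..} \<longrightarrow> exp (- (s * of_real x)) * w_powr (b + 1 - 1) x =
      exp (- (s * of_real x)) * w_powr (b - 1) x
      - exp (- ((s + 1) * of_real x)) * w_powr (b - 1) x"
    proof (intro allI impI)
      fix x :: real assume "x \<in> {0<..}"
      have "w powr (b + 1 - 1) = w powr (b - 1) - (1 - w) * w powr (b - 1)" if "w > 0" for w
        using that by (simp add: powr_diff field_simps)
      from this[of "1 - exp (-x)"] \<open>x \<in> {0<..}\<close>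
      have *: "(1 - exp (-x)) powr (b + 1 - 1) = (1 - exp (-x)) powr (b - 1) - exp (-x) * (1 - exp (-x)) powr (b - 1)"
        by simp
      have "exp (- ((s + 1) * of_real x)) = exp (- (s * of_real x)) * of_real (exp (-x))"
        by (simp add: algebra_simps exp_add[symmetric] exp_of_real[symmetric])
      then show "exp (- (s * of_real x)) * w_powr (b + 1 - 1) x =
          exp (- (s * of_real x)) * w_powr (b - 1) x
          - exp (- ((s + 1) * of_real x)) * w_powr (b - 1) x"
        by (simp only: *) (simp add: algebra_simps)
    qed
  qed auto
  also have "\<dots> = beta_integral s b - beta_integral (s + 1) b"
    unfolding beta_integral_def using assms by (intro set_integral_diff(2) beta_integrable) auto
  finally show ?thesis .
qed

lemma beta_integral_shift:
  assumes s: "Re s > 0" and b: "b > 0"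
  shows "(s + of_real b) * beta_integral (s + 1) b = s * beta_integral s b"
  using beta_integral_by_parts[OF assms] unfolding beta_integral_split[OF assms]
  by (simp add: algebra_simps)

lemma beta_integral_shift_nat:
  assumes s: "Re s > 0" and b: "b > 0"
  shows "pochhammer (s + of_real b) n * beta_integral (s + of_nat n) b = pochhammer s n * beta_integral s b"
proof (induction n)
  case (Suc n)
  have "pochhammer (s + of_real b) (Suc n) * beta_integral (s + of_nat (Suc n)) b
      = pochhammer (s + of_real b) n * ((s + of_nat n + of_real b) * beta_integral (s + of_nat n + 1) b)"
    by (simp add: pochhammer_Suc algebra_simps)
  also have "(s + of_nat n + of_real b) * beta_integral (s + of_nat n + 1) b = (s + of_nat n) * beta_integral (s + of_nat n) b"
    using assms by (intro beta_integral_shift) auto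
  also have "pochhammer (s + of_real b) n * \<dots> = pochhammer s (Suc n) * beta_integral s b"
    using Suc.IH by (simp add: pochhammer_Suc algebra_simps)
  finally show ?case .
qed auto

lemma beta_integral_1:
  assumes b: "b > 0"
  shows "beta_integral 1 b = 1 / of_real b"
proof -
  have "(CLINT x:{0<..}|lborel. of_real b * (exp (- (1 * of_real x)) * w_powr (b - 1) x)) = of_real 1 - of_real 0"
  proof (rule half_line_FTC)
    fix x :: real assume x: "x > 0"
    have "((\<lambda>x. (1 - exp (-x)) powr b) has_real_derivative b * (1 - exp (-x)) powr (b - 1) * exp (-x)) (at x)"
      using x by (auto intro!: derivative_eq_intros simp: powr_diff field_simps)
    then have "((\<lambda>x. w_powr b x) has_vector_derivative
            of_real (b * (1 - exp (-x)) powr (b - 1) * exp (-x))) (at x)"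
      by (intro has_vector_derivative_of_real) (simp add: has_real_derivative_iff_has_vector_derivative)
    then show "((\<lambda>x. w_powr b x) has_vector_derivative
            of_real b * (exp (- (1 * of_real x)) * w_powr (b - 1) x)) (at x)"
      by (simp add: exp_of_real[symmetric] mult_ac)
  next
    show "set_integrable lborel {0<..} (\<lambda>x. complex_of_real b * (exp (- (1 * of_real x)) * w_powr (b - 1) x))"
      using b by (intro set_integrable_mult_right beta_integrable) auto
    show "((\<lambda>x. w_powr b x) \<longlongrightarrow> of_real 0) (at_right 0)"
      using b by (intro tendsto_of_real) real_asymp
    show "((\<lambda>x. w_powr b x) \<longlongrightarrow> of_real 1) at_top"
      by (intro tendsto_of_real) real_asymp
  qed (intro continuous_intros)
  also have "(CLINT x:{0<..}|lborel. of_real b * (exp (- (1 * of_real x)) * w_powr (b - 1) x)) = of_real b * beta_integral 1 b"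
    unfolding beta_integral_def by (rule set_integral_mult_right)
  finally show ?thesis using b by (simp add: field_simps)
qed

lemma pochhammer_nonzero:
  fixes s :: complex assumes "Re s > 0"
  shows "pochhammer s n \<noteq> 0"
proof
  assume "pochhammer s n = 0"
  then obtain k where "s = - of_nat k" by (auto simp: pochhammer_eq_0_iff)
  then show False using assms by simp
qed

lemma Re_pos_imp_not_nonpos_Int:
  fixes z :: complex assumes "Re z > 0"
  shows "z \<notin> \<int>\<^sub>\<le>\<^sub>0"
proof
  assume "z \<in> \<int>\<^sub>\<le>\<^sub>0"
  then obtain n where "z = of_int n" "n \<le> 0" by (auto elim!: nonpos_Ints_cases)
  then show False using assms by simp
qed

text \<open>
  Multiplied by \<open>n powr b\<close>, the right-hand side is the \<open>n\<close>-th term of Euler's limit formula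
  for \<open>\<Gamma>(b)\<close>.
\<close>
lemma beta_integral_nat_plus_1:
  assumes b: "b > 0"
  shows "beta_integral (1 + of_nat n) b = fact n / pochhammer (of_real b) (n + 1)"
proof -
  have nz: "pochhammer (of_real b :: complex) k \<noteq> 0" "pochhammer (1 + of_real b :: complex) k \<noteq> 0" for k
    using b by (simp_all add: pochhammer_nonzero)
  have "pochhammer (1 + of_real b) n * beta_integral (1 + of_nat n) b = fact n / of_real b"
    using beta_integral_shift_nat[of 1 b n] b by (simp add: beta_integral_1 pochhammer_fact)
  then show ?thesis using nz b by (simp add: pochhammer_rec field_simps add_ac)
qed

text \<open>
  The derivative of \<open>exp\<close> is bounded by \<open>1\<close> on the left half-plane.
\<close>
lemma norm_exp_minus_1_le:
  fixes z :: complex assumes "Re z \<le> 0"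
  shows "norm (exp z - 1) \<le> norm z"
proof -
  have "norm (exp z - exp 0) \<le> 1 * norm (z - 0)"
  proof (rule field_differentiable_bound)
    show "convex {z. Re z \<le> 0}" by (rule convex_halfspace_Re_le)
    show "(exp has_field_derivative exp z) (at z within {z. Re z \<le> 0})" for z :: complex
      by (rule has_field_derivative_at_within[OF DERIV_exp])
  qed (use assms in auto)
  then show ?thesis by simp
qed

text \<open>
  In \<open>\<bar>exp(-s x) - 1\<bar> \<le> \<bar>s\<bar> x\<close> the factor \<open>x\<close> is traded for \<open>w\<close> through
  \<open>x exp(-x) \<le> 1 - exp(-x)\<close>. This raises the second argument of the Beta integral by one, so the
  bound is smaller by a factor of order \<open>1/n\<close> than the integrals on the left.
\<close>
lemma beta_integral_diff_le:
  assumes s: "Re s \<ge> 0" and b: "b > 0" and n: "n > 0"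
  shows "norm (beta_integral (s + 1 + of_nat n) b - beta_integral (1 + of_nat n) b)
    \<le> norm s * norm (beta_integral (of_nat n) (b + 1))"
proof -
  let ?w = "\<lambda>x::real. 1 - exp (-x)"
  have eq: "beta_integral (s + 1 + of_nat n) b - beta_integral (1 + of_nat n) b =
    (CLINT x:{0<..}|lborel. exp (- ((s + 1 + of_nat n) * of_real x)) * of_real (?w x powr (b - 1))
         - exp (- ((1 + of_nat n) * of_real x)) * of_real (?w x powr (b - 1)))"
    unfolding beta_integral_def
    using s b by (intro set_integral_diff(2)[symmetric] beta_integrable) auto
  have "norm (beta_integral (s + 1 + of_nat n) b - beta_integral (1 + of_nat n) b)
      \<le> (LINT x:{0<..}|lborel. norm s * (exp (- (real n * x)) * ?w x powr b))"
    unfolding eq set_lebesgue_integral_def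
  proof (rule Bochner_Integration.integral_norm_bound_integral)
    show "integrable lborel (\<lambda>x. indicat_real {0<..} x *\<^sub>R (exp (- ((s + 1 + of_nat n) * of_real x)) * complex_of_real (?w x powr (b - 1))
         - exp (- ((1 + of_nat n) * of_real x)) * of_real (?w x powr (b - 1))))"
      unfolding set_integrable_def[symmetric]
      using s b by (intro set_integral_diff(1) beta_integrable) auto
    have "set_integrable lborel {0<..} (\<lambda>x. norm s * norm (exp (- (of_nat n * of_real x)) * complex_of_real (?w x powr (b + 1 - 1))))"
      using n b by (intro set_integrable_mult_right set_integrable_norm beta_integrable) auto
    then show "integrable lborel (\<lambda>x. indicat_real {0<..} x *\<^sub>R (norm s * (exp (- (real n * x)) * ?w x powr b)))"
      by (simp add: set_integrable_def norm_mult)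
    fix x
    show "norm (indicat_real {0<..} x *\<^sub>R (exp (- ((s + 1 + of_nat n) * of_real x)) * complex_of_real (?w x powr (b - 1))
         - exp (- ((1 + of_nat n) * of_real x)) * of_real (?w x powr (b - 1)))) \<le> indicat_real {0<..} x *\<^sub>R (norm s * (exp (- (real n * x)) * ?w x powr b))"
    proof (cases "x > 0")
      case True
      have "exp (- ((s + 1 + of_nat n) * of_real x)) * complex_of_real (?w x powr (b - 1))
         - exp (- ((1 + of_nat n) * of_real x)) * of_real (?w x powr (b - 1))
         = exp (- ((1 + of_nat n) * of_real x)) * (exp (- (s * of_real x)) - 1) * of_real (?w x powr (b - 1))"
        by (simp add: algebra_simps exp_add exp_diff exp_minus field_simps)
      also have "norm \<dots> = exp (- ((1 + real n) * x)) * norm (exp (- (s * of_real x)) - 1) * ?w x powr (b - 1)"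
        by (simp only: norm_mult norm_exp_eq_Re norm_of_real) simp
      also have "\<dots> = exp (- (real n * x)) * exp (-x) * norm (exp (- (s * of_real x)) - 1) * ?w x powr (b - 1)"
        unfolding exp_add[symmetric] by (simp add: algebra_simps)
      also have "\<dots> \<le> exp (- (real n * x)) * exp (-x) * (norm s * x) * ?w x powr (b - 1)"
      proof -
        have "norm (exp (- (s * of_real x)) - 1) \<le> norm s * x"
          using norm_exp_minus_1_le[of "- (s * of_real x)"] s True by (simp add: norm_mult)
        then show ?thesis by (intro mult_left_mono mult_right_mono) auto
      qed
      also have "\<dots> = norm s * exp (- (real n * x)) * (x * exp (-x)) * ?w x powr (b - 1)" by (simp add: mult_ac)
      also have "\<dots> \<le> norm s * exp (- (real n * x)) * ?w x * ?w x powr (b - 1)"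
      proof -
        have "(1 + x) * exp (-x) \<le> exp x * exp (-x)"
          by (intro mult_right_mono exp_ge_add_one_self) auto
        then have "x * exp (-x) \<le> ?w x" by (simp add: exp_add[symmetric] algebra_simps)
        then show ?thesis by (intro mult_left_mono mult_right_mono) auto
      qed
      also have "\<dots> = norm s * (exp (- (real n * x)) * ?w x powr b)"
        using True by (simp add: powr_diff)
      finally show ?thesis using True by simp
    qed auto
  qed
  then have le: "norm (beta_integral (s + 1 + of_nat n) b - beta_integral (1 + of_nat n) b)
    \<le> norm s * (LINT x:{0<..}|lborel. exp (- (real n * x)) * ?w x powr b)"
    by (simp only: set_integral_mult_right)
  have "complex_of_real (LINT x:{0<..}|lborel. exp (- (real n * x)) * ?w x powr b) = beta_integral (of_nat n) (b + 1)"
    unfolding beta_integral_def set_integral_complex_of_real[symmetric] by (simp add: exp_of_real[symmetric])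
  then have "(LINT x:{0<..}|lborel. exp (- (real n * x)) * ?w x powr b) \<le> norm (beta_integral (of_nat n) (b + 1))"
    by (metis abs_ge_self norm_of_real)
  then show ?thesis by (intro order_trans[OF le] mult_left_mono) auto
qed

text \<open>
  By the recurrence, \<open>B(s, b)\<close> is the ratio of the terms of Euler's limit formulas for \<open>\<Gamma>(s)\<close>
  and \<open>\<Gamma>(s + b)\<close>, times \<open>n powr b * B(s + 1 + n, b)\<close>. The last factor has the same limit for
  all \<open>s\<close>, and for \<open>s = 0\<close> it is again a term of the formula, for \<open>\<Gamma>(b)\<close>.
\<close>
theorem beta_integral_eq_Gamma:
  assumes s: "Re s > 0" and b: "b > 0"
  shows "beta_integral s b = Gamma s * Gamma (of_real b) * rGamma (s + of_real b)"
proof -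
  define c where "c = (\<lambda>n. complex_of_real (real n powr b))"
  have c: "c n * beta_integral (1 + of_nat n) b = Gamma_series (of_real b) n" if "n > 0" for n
  proof -
    have "c n = exp (of_real b * of_real (ln (real n)))"
      using that by (simp add: c_def powr_def exp_of_real[symmetric])
    then show ?thesis by (simp add: beta_integral_nat_plus_1[OF b] Gamma_series_def)
  qed
  have lim1: "(\<lambda>n. c n * beta_integral (1 + of_nat n) b) \<longlonglongrightarrow> Gamma (of_real b)"
    by (rule Lim_transform_eventually[OF Gamma_series_LIMSEQ eventually_mono[OF eventually_gt_at_top[of 0]]])
       (simp add: c)
  have lim2: "(\<lambda>n. c n * (beta_integral (s + 1 + of_nat n) b - beta_integral (1 + of_nat n) b)) \<longlonglongrightarrow> 0"
  proof (rule Lim_null_comparison)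
    have "(\<lambda>n. norm s * b * inverse (real n) * norm (c n * beta_integral (1 + of_nat n) b)) \<longlonglongrightarrow> norm s * b * 0 * norm (Gamma (complex_of_real b))"
      by (intro tendsto_intros lim1 lim_inverse_n)
    then show "(\<lambda>n. norm s * b * inverse (real n) * norm (c n * beta_integral (1 + of_nat n) b)) \<longlonglongrightarrow> 0" by simp
    show "\<forall>\<^sub>F n in sequentially. norm (c n * (beta_integral (s + 1 + of_nat n) b - beta_integral (1 + of_nat n) b)) \<le>
        norm s * b * inverse (real n) * norm (c n * beta_integral (1 + of_nat n) b)"
      using eventually_gt_at_top[of 0]
    proof eventually_elim
      case (elim n)
      \<comment> \<open>The two recurrences give \<open>n B(n, b + 1) = b B(n + 1, b)\<close>, the gain of a factor \<open>1/n\<close>.\<close>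
      have 1: "of_real b * beta_integral (of_nat n) b = (of_nat n + of_real b) * beta_integral (of_nat n) (b + 1)"
        using b elim by (intro beta_integral_by_parts) auto
      have 2: "(of_nat n + of_real b) * beta_integral (1 + of_nat n) b = of_nat n * beta_integral (of_nat n) b"
        using b elim beta_integral_shift[of "of_nat n" b] by (simp add: add_ac)
      have nz: "(of_nat n + of_real b :: complex) \<noteq> 0" 
        using b by (auto simp: complex_eq_iff)
      have "(of_nat n + of_real b) * (of_nat n * beta_integral (of_nat n) (b + 1))
          = (of_nat n + of_real b) * (of_real b * beta_integral (1 + of_nat n) b)"
        using 1 2 by (metis mult.left_commute)
      then have "of_nat n * beta_integral (of_nat n) (b + 1) = of_real b * beta_integral (1 + of_nat n) b"
        using nz by simp
      then have "beta_integral (of_nat n) (b + 1) = of_real (b * inverse (real n)) * beta_integral (1 + of_nat n) b"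
        using elim by (simp add: field_simps)
      then have "norm (beta_integral (of_nat n) (b + 1)) = b * inverse (real n) * norm (beta_integral (1 + of_nat n) b)"
        using b by (simp only: norm_mult norm_of_real abs_mult abs_inverse abs_of_nat abs_of_pos)
      then have "norm (beta_integral (s + 1 + of_nat n) b - beta_integral (1 + of_nat n) b)
        \<le> norm s * (b * inverse (real n) * norm (beta_integral (1 + of_nat n) b))"
        using beta_integral_diff_le[of s b n] s b elim by simp
      then have "norm (c n) * norm (beta_integral (s + 1 + of_nat n) b - beta_integral (1 + of_nat n) b)
        \<le> norm (c n) * (norm s * (b * inverse (real n) * norm (beta_integral (1 + of_nat n) b)))"
        by (intro mult_left_mono) auto
      then show ?case by (simp add: norm_mult mult_ac)
    qed
  qed
  have lim3: "(\<lambda>n. c n * beta_integral (s + 1 + of_nat n) b) \<longlonglongrightarrow> Gamma (of_real b)"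
    using tendsto_add[OF lim1 lim2] by (simp add: algebra_simps)
  have sb: "s + of_real b \<notin> \<int>\<^sub>\<le>\<^sub>0" using s b by (intro Re_pos_imp_not_nonpos_Int) simp
  then have "(\<lambda>n. Gamma_series s n / Gamma_series (s + of_real b) n * (c n * beta_integral (s + 1 + of_nat n) b)) \<longlonglongrightarrow>
     Gamma s / Gamma (s + of_real b) * Gamma (of_real b)"
    by (intro tendsto_intros lim3) (simp add: Gamma_eq_zero_iff)
  moreover have "\<forall>\<^sub>F n in sequentially. Gamma_series s n / Gamma_series (s + of_real b) n * (c n * beta_integral (s + 1 + of_nat n) b) = beta_integral s b"
    using eventually_gt_at_top[of 0]
  proof eventually_elim
    case (elim n)
    have nz: "pochhammer s (n + 1) \<noteq> 0" "pochhammer (s + of_real b) (n + 1) \<noteq> 0"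
      using s b by (simp_all add: pochhammer_nonzero)
    have cn: "c n = exp (of_real b * of_real (ln (real n)))"
      using elim by (simp add: c_def powr_def exp_of_real[symmetric])
    have "Gamma_series s n / Gamma_series (s + of_real b) n * c n = pochhammer (s + of_real b) (n + 1) / pochhammer s (n + 1)"
      using nz by (simp add: Gamma_series_def cn ring_distribs exp_add field_simps)
    moreover have "pochhammer (s + of_real b) (n + 1) * beta_integral (s + 1 + of_nat n) b = pochhammer s (n + 1) * beta_integral s b"
      using beta_integral_shift_nat[OF s b, of "n + 1"] by (simp add: add_ac)
    ultimately show ?case using nz by (simp add: mult.assoc[symmetric])
  qed
  ultimately have "(\<lambda>n. beta_integral s b) \<longlonglongrightarrow> Gamma s / Gamma (s + of_real b) * Gamma (of_real b)"
    by (rule Lim_transform_eventually)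
  then have "beta_integral s b = Gamma s / Gamma (s + of_real b) * Gamma (of_real b)"
    by (simp add: LIMSEQ_const_iff)
  then show ?thesis by (simp add: rGamma_inverse_Gamma field_simps)
qed

section \<open>Differences of Beta integrals across the pole\<close>

text \<open>
  The regularised \<open>B(1, 1 - a) - B(s, 1 - a)\<close>: the zero of the numerator at \<open>x = 0\<close> extends
  the range of convergence from \<open>a < 1\<close> to \<open>a < 2\<close>, across the pole at \<open>a = 1\<close>.
\<close>
definition beta_diff :: "real \<Rightarrow> complex \<Rightarrow> complex" where
  "beta_diff a s = (CLINT x:{0<..}|lborel. (exp (- of_real x) - exp (- (s * of_real x))) * w_powr (- a) x)"

lemma exp_diff_bigo_at_0:
  fixes s :: complex
  shows "(\<lambda>x. exp (- of_real x) - exp (- (s * of_real x))) \<in> O[at_right 0](\<lambda>x. of_real (x powr 1))"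
  using sum_in_bigo(2)[OF exp_minus_one_bigo(1)[of "-1"] exp_minus_one_bigo(1)[of "-s"]]
  by simp

lemma exp_diff_bigo_at_top:
  fixes s :: complex
  assumes "Re s > 0" "\<delta> = min 1 (Re s)"
  shows "(\<lambda>x. exp (- of_real x) - exp (- (s * of_real x))) \<in> O(\<lambda>x. of_real (exp (- (\<delta> * x))))"
  using sum_in_bigo(2)[OF exp_bigo_at_top[of \<delta> 1] exp_bigo_at_top[of \<delta> s]] assms(2) by simp

lemma beta_diff_integrable:
  assumes "Re s > 0" "a < 2"
  shows "set_integrable lborel {0<..} (\<lambda>x. (exp (- of_real x) - exp (- (s * of_real x))) * w_powr (- a) x)"
  by (rule set_integrable_half_line_powr[OF _ exp_diff_bigo_at_0 _ exp_diff_bigo_at_top[OF _ refl]])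
     (use assms in \<open>auto intro!: continuous_intros\<close>)

lemma beta_diff_less_1:
  assumes s: "Re s > 0" and a: "a < 1"
  shows "beta_diff a s = beta_integral 1 (1 - a) - beta_integral s (1 - a)"
proof -
  have "beta_diff a s = (CLINT x:{0<..}|lborel. exp (- (1 * of_real x)) * w_powr (1 - a - 1) x
     - exp (- (s * of_real x)) * w_powr (1 - a - 1) x)"
    by (simp add: beta_diff_def algebra_simps)
  also have "\<dots> = beta_integral 1 (1 - a) - beta_integral s (1 - a)"
    unfolding beta_integral_def using assms
    by (intro set_integral_diff(2) beta_integrable) auto
  finally show ?thesis .
qed

text \<open>
  Integration by parts with a simple zero (\<open>m = 1\<close>, \<open>b = 1 - a\<close>). The second argument
  \<open>2 - a\<close> of the Beta integrals that it produces is positive.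
\<close>
lemma beta_diff_greater_1:
  assumes s: "Re s > 0" and a: "1 < a" "a < 2"
  shows "of_real (a - 1) * beta_diff a s =
           (s + of_real (1 - a)) * beta_integral s (2 - a) - of_real (2 - a) * beta_integral 1 (2 - a)"
proof -
  define \<delta> where "\<delta> = min 1 (Re s)"
  have "\<delta> > 0" using s by (simp add: \<delta>_def)
  have "- of_real (1 - a) * (CLINT x:{0<..}|lborel. (exp (- of_real x) - exp (- (s * of_real x))) * w_powr (1 - a - 1) x)
     = (CLINT x:{0<..}|lborel. (- exp (- of_real x) + s * exp (- (s * of_real x))
          - of_real (1 - a) * (exp (- of_real x) - exp (- (s * of_real x)))) * w_powr (1 - a) x)"
  proof (rule integral_by_parts_powr[where m = 1])
    show "((\<lambda>x. exp (- of_real x) - exp (- (s * of_real x))) has_vector_derivative - exp (- of_real x) + s * exp (- (s * of_real x))) (at x)" for x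
      by (auto intro!: derivative_eq_intros has_vector_derivative_real_field)
    show "(\<lambda>x. exp (- of_real x) - exp (- (s * of_real x))) \<in> O[at_right 0](\<lambda>x. of_real (x powr 1))"
      by (rule exp_diff_bigo_at_0)
    show "(\<lambda>x. exp (- of_real x) - exp (- (s * of_real x))) \<in> O(\<lambda>x. of_real (exp (- (\<delta> * x))))"
      by (rule exp_diff_bigo_at_top[OF s \<delta>_def])
    show "(\<lambda>x. - exp (- of_real x) + s * exp (- (s * of_real x))) \<in> O[at_right 0](\<lambda>x. of_real (x powr (1 - 1)))"
      using sum_in_bigo(2)[OF bigo_cmult[OF exp_bigo_at_0[of s]] exp_bigo_at_0[of 1]] by (simp add: add_ac)
    show "(\<lambda>x. - exp (- of_real x) + s * exp (- (s * of_real x))) \<in> O(\<lambda>x. of_real (exp (- (\<delta> * x))))"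
      using sum_in_bigo(2)[OF bigo_cmult[OF exp_bigo_at_top[of \<delta> s]] exp_bigo_at_top[of \<delta> 1]]
      by (simp add: add_ac \<delta>_def)
  qed (use a \<open>\<delta> > 0\<close> in \<open>auto intro!: continuous_intros\<close>)
  also have "\<dots> = (CLINT x:{0<..}|lborel. (s + of_real (1 - a)) * (exp (- (s * of_real x)) * w_powr (2 - a - 1) x)
       - of_real (2 - a) * (exp (- (1 * of_real x)) * w_powr (2 - a - 1) x))"
    by (intro set_lebesgue_integral_cong) (auto simp: algebra_simps)
  also have "\<dots> = (s + of_real (1 - a)) * beta_integral s (2 - a) - of_real (2 - a) * beta_integral 1 (2 - a)"
    unfolding beta_integral_def set_integral_mult_right[symmetric] using assms
    by (intro set_integral_diff(2) set_integrable_mult_right beta_integrable) auto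
  finally show ?thesis by (simp add: beta_diff_def)
qed

text \<open>
  For \<open>1 < a < 2\<close> this is the analytic continuation in \<open>a\<close> of the convergent case, obtained
  from the functional equation of \<open>\<Gamma>\<close> at \<open>1 - a\<close> and at \<open>s + 1 - a\<close>. The reciprocal
  \<open>rGamma\<close> avoids a case distinction when \<open>s + 1 - a\<close> is a pole.
\<close>
lemma beta_diff_eq_Gamma:
  assumes s: "Re s > 0" and a: "a < 2" "a \<noteq> 1"
  shows "beta_diff a s = 1 / of_real (1 - a) - Gamma s * Gamma (of_real (1 - a)) * rGamma (s + of_real (1 - a))"
proof (cases "a < 1")
  case True
  then show ?thesis using s by (simp add: beta_diff_less_1 beta_integral_1 beta_integral_eq_Gamma[OF s])
next
  case False
  then have a1: "1 < a" using a by simp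
  have rG: "rGamma (s + of_real (1 - a)) = (s + of_real (1 - a)) * rGamma (s + of_real (2 - a))"
    using rGamma_plus1[of "s + of_real (1 - a)"] by (simp add: algebra_simps)
  have "complex_of_real (1 - a) \<notin> \<int>\<^sub>\<le>\<^sub>0"
  proof
    assume "complex_of_real (1 - a) \<in> \<int>\<^sub>\<le>\<^sub>0"
    then obtain n where "complex_of_real (1 - a) = - of_nat n" by (auto elim!: nonpos_Ints_cases')
    then have "1 - a = - real n" by (metis of_real_eq_iff of_real_minus of_real_of_nat_eq)
    then show False using a1 a by (cases n) auto
  qed
  then have G: "Gamma (complex_of_real (2 - a)) = of_real (1 - a) * Gamma (of_real (1 - a))"
    using Gamma_plus1[of "complex_of_real (1 - a)"] by (simp add: algebra_simps)
  have "of_real (a - 1) * beta_diff a s = (s + of_real (1 - a)) * (Gamma s * Gamma (of_real (2 - a)) * rGamma (s + of_real (2 - a))) - of_real (2 - a) * (1 / of_real (2 - a))"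
    using beta_diff_greater_1[OF s a1 a(1)] a
    by (simp only: beta_integral_1[of "2 - a"] beta_integral_eq_Gamma[OF s, of "2 - a"] diff_gt_0_iff_gt)
  also have "\<dots> = of_real (1 - a) * (Gamma s * Gamma (of_real (1 - a)) * rGamma (s + of_real (1 - a))) - 1"
  proof -
    have "complex_of_real (2 - a) \<noteq> 0" using a by (subst of_real_eq_0_iff) simp
    then show ?thesis by (simp only: G rG) (simp add: algebra_simps)
  qed
  also have "\<dots> = of_real (a - 1) * (1 / of_real (1 - a) - Gamma s * Gamma (of_real (1 - a)) * rGamma (s + of_real (1 - a)))"
    using a1 by (simp add: field_simps)
  finally show ?thesis using a1 by (subst (asm) mult_cancel_left) auto
qed

text \<open>
  The increment carries an additional factor \<open>w\<close>, hence a Beta integral that converges.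
\<close>
lemma beta_diff_shift:
  assumes s: "Re s > 0" and a: "a < 2"
  shows "beta_diff a (s + 1) = beta_diff a s + beta_integral s (2 - a)"
proof -
  have "beta_diff a (s + 1) = (CLINT x:{0<..}|lborel.
     (exp (- of_real x) - exp (- (s * of_real x))) * w_powr (- a) x
     + exp (- (s * of_real x)) * w_powr (2 - a - 1) x)"
    unfolding beta_diff_def
  proof (rule set_lebesgue_integral_cong)
    show "\<forall>x. x \<in> {0<..} \<longrightarrow> (exp (- of_real x) - exp (- ((s + 1) * of_real x))) * w_powr (- a) x =
      (exp (- of_real x) - exp (- (s * of_real x))) * w_powr (- a) x
      + exp (- (s * of_real x)) * w_powr (2 - a - 1) x"
    proof (intro allI impI)
      fix x :: real assume x: "x \<in> {0<..}"
      have "(1 - exp (-x)) powr (2 - a - 1) = (1 - exp (-x)) powr 1 * (1 - exp (-x)) powr (- a)"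
        unfolding powr_add[symmetric] by simp
      then have *: "w_powr (2 - a - 1) x = (1 - exp (- of_real x)) * w_powr (- a) x"
        using x by (simp add: exp_of_real[symmetric])
      have "exp (- ((s + 1) * of_real x)) = exp (- (s * of_real x)) * exp (- of_real x)"
        by (simp add: algebra_simps exp_add[symmetric])
      then show "(exp (- of_real x) - exp (- ((s + 1) * of_real x))) * w_powr (- a) x =
          (exp (- of_real x) - exp (- (s * of_real x))) * w_powr (- a) x
          + exp (- (s * of_real x)) * w_powr (2 - a - 1) x"
        unfolding * by (simp add: algebra_simps)
    qed
  qed auto
  also have "\<dots> = beta_diff a s + beta_integral s (2 - a)"
    unfolding beta_diff_def beta_integral_def using assms
    by (intro set_integral_add(2) beta_diff_integrable beta_integrable) auto
  finally show ?thesis .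
qed

lemma beta_diff_2:
  assumes a: "a < 2"
  shows "beta_diff a 2 = 1 / of_real (2 - a)"
proof -
  have "beta_diff a 1 = 0" by (simp add: beta_diff_def)
  then show ?thesis using beta_diff_shift[of 1 a] a by (simp add: beta_integral_1)
qed

lemma beta_diff_1_shift_nat:
  assumes s: "Re s > 0"
  shows "beta_diff 1 (s + of_nat n) = beta_diff 1 s + (\<Sum>k<n. inverse (s + of_nat k))"
proof (induction n)
  case (Suc n)
  have "Re (s + of_nat n) > 0" using s by (simp add: add_pos_nonneg)
  then have "s + of_nat n \<notin> \<int>\<^sub>\<le>\<^sub>0" by (rule Re_pos_imp_not_nonpos_Int)
  then have "s + of_nat n \<noteq> 0" by auto
  have "beta_integral (s + of_nat n) (2 - 1) = inverse (s + of_nat n)"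
  proof -
    have "beta_integral (s + of_nat n) (2 - 1) = Gamma (s + of_nat n) * rGamma (s + of_nat n + 1)"
      using beta_integral_eq_Gamma[of "s + of_nat n" 1] \<open>Re (s + of_nat n) > 0\<close> by simp
    also have "(s + of_nat n) * \<dots> = Gamma (s + of_nat n) * rGamma (s + of_nat n)"
      using rGamma_plus1[of "s + of_nat n"] by (simp add: mult_ac)
    also have "\<dots> = 1" 
      using \<open>s + of_nat n \<notin> \<int>\<^sub>\<le>\<^sub>0\<close> by (simp add: rGamma_inverse_Gamma Gamma_eq_zero_iff)
    finally show ?thesis
      using \<open>s + of_nat n \<noteq> 0\<close> by (simp add: inverse_unique)
  qed
  then show ?case
    using beta_diff_shift[of "s + of_nat n" 1] \<open>Re (s + of_nat n) > 0\<close> Suc.IH by (simp add: add_ac)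
qed auto

text \<open>
  The factor \<open>exp(-n x)\<close> tends to \<open>0\<close> pointwise, dominated by the integrand for \<open>n = 0\<close>.
\<close>
lemma beta_diff_1_asymptotics:
  assumes s: "Re s > 0"
  shows "(\<lambda>n. beta_diff 1 (s + of_nat n) - beta_diff 1 (1 + of_nat n)) \<longlonglongrightarrow> 0"
proof -
  let ?g = "\<lambda>x. (exp (- of_real x) - exp (- (s * of_real x))) * w_powr (- 1) x"
  have eq: "beta_diff 1 (s + of_nat n) - beta_diff 1 (1 + of_nat n) =
     (CLINT x:{0<..}|lborel. of_real (exp (- (real n * x))) * ?g x)" for n
  proof -
    have "beta_diff 1 (s + of_nat n) - beta_diff 1 (1 + of_nat n) = (CLINT x:{0<..}|lborel.
       (exp (- of_real x) - exp (- ((s + of_nat n) * of_real x))) * w_powr (- 1) x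
        - (exp (- of_real x) - exp (- ((1 + of_nat n) * of_real x))) * w_powr (- 1) x)"
      unfolding beta_diff_def using s
      by (intro set_integral_diff(2)[symmetric] beta_diff_integrable) (auto simp: add_pos_nonneg)
    also have "\<dots> = (CLINT x:{0<..}|lborel. of_real (exp (- (real n * x))) * ?g x)"
    proof (intro set_lebesgue_integral_cong allI impI)
      fix x :: real
      have "exp (- ((s + of_nat n) * of_real x)) = exp (- (s * of_real x)) * of_real (exp (- (real n * x)))"
        "exp (- ((1 + of_nat n) * of_real x)) = exp (- of_real x) * complex_of_real (exp (- (real n * x)))"
        by (simp_all add: exp_of_real[symmetric] exp_add[symmetric] algebra_simps)
      then show "(exp (- of_real x) - exp (- ((s + of_nat n) * of_real x))) * w_powr (- 1) x
        - (exp (- of_real x) - exp (- ((1 + of_nat n) * of_real x))) * w_powr (- 1) x = of_real (exp (- (real n * x))) * ?g x"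
        by (simp only:) (simp add: algebra_simps)
    qed auto
    finally show ?thesis .
  qed
  have int: "set_integrable lborel {0<..} ?g" using s by (intro beta_diff_integrable) auto
  then have meas: "(\<lambda>x. indicat_real {0<..} x *\<^sub>R ?g x) \<in> borel_measurable lborel"
    unfolding set_integrable_def by (rule borel_measurable_integrable)
  have "(\<lambda>n. integral\<^sup>L lborel (\<lambda>x. of_real (exp (- (real n * x))) * (indicat_real {0<..} x *\<^sub>R ?g x))) \<longlonglongrightarrow> integral\<^sup>L lborel (\<lambda>x::real. 0)"
  proof (rule integral_dominated_convergence[where w = "\<lambda>x. norm (indicat_real {0<..} x *\<^sub>R ?g x)"])
    show "integrable lborel (\<lambda>x. norm (indicat_real {0<..} x *\<^sub>R ?g x))"
      using int unfolding set_integrable_def by (rule integrable_norm)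
    show "AE x in lborel. (\<lambda>n. of_real (exp (- (real n * x))) * (indicat_real {0<..} x *\<^sub>R ?g x)) \<longlonglongrightarrow> 0"
    proof (rule AE_I2)
      fix x :: real
      show "(\<lambda>n. of_real (exp (- (real n * x))) * (indicat_real {0<..} x *\<^sub>R ?g x)) \<longlonglongrightarrow> 0"
      proof (cases "x > 0")
        case True
        then have "(\<lambda>n. exp (- (real n * x))) \<longlonglongrightarrow> 0" by real_asymp
        then have "(\<lambda>n. complex_of_real (exp (- (real n * x)))) \<longlonglongrightarrow> of_real 0" by (rule tendsto_of_real)
        then have "(\<lambda>n. complex_of_real (exp (- (real n * x))) * (indicat_real {0<..} x *\<^sub>R ?g x)) \<longlonglongrightarrow> of_real 0 * (indicat_real {0<..} x *\<^sub>R ?g x)"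
          by (intro tendsto_mult tendsto_const)
        then show ?thesis by simp
      qed simp
    qed
    show "AE x in lborel. norm (of_real (exp (- (real n * x))) * (indicat_real {0<..} x *\<^sub>R ?g x)) \<le> norm (indicat_real {0<..} x *\<^sub>R ?g x)" for n
    proof (rule AE_I2)
      fix x :: real
      show "norm (of_real (exp (- (real n * x))) * (indicat_real {0<..} x *\<^sub>R ?g x)) \<le> norm (indicat_real {0<..} x *\<^sub>R ?g x)"
      proof (cases "x > 0")
        case True
        then show ?thesis unfolding norm_mult by (intro mult_left_le_one_le) auto
      qed simp
    qed
  qed (use meas in measurable)
  then show ?thesis
    by (simp add: eq set_lebesgue_integral_def)
qed

text \<open>
  Gauss's integral for \<open>\<psi>\<close>. Shifting by \<open>n\<close> produces the partial sums of the series of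
  \<open>\<psi>(s) - \<psi>(1)\<close>, and the shifted integrals cancel in the limit.
\<close>
theorem beta_diff_1_eq_Digamma:
  assumes s: "Re s > 0"
  shows "beta_diff 1 s = Digamma s + euler_mascheroni"
proof -
  have "s \<noteq> 0" using s by auto
  have "(\<lambda>m. (of_real (ln (real m)) - (\<Sum>k<m. inverse (s + of_nat k)))
            - (of_real (ln (real m)) - (\<Sum>k<m. inverse (1 + of_nat k)))
            + (beta_diff 1 (s + of_nat m) - beta_diff 1 (1 + of_nat m))) \<longlonglongrightarrow> Digamma s - Digamma 1 + 0"
    using \<open>s \<noteq> 0\<close> s by (intro tendsto_add tendsto_diff Digamma_LIMSEQ beta_diff_1_asymptotics) auto
  also have "(\<lambda>m. (of_real (ln (real m)) - (\<Sum>k<m. inverse (s + of_nat k)))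
            - (of_real (ln (real m)) - (\<Sum>k<m. inverse (1 + of_nat k)))
            + (beta_diff 1 (s + of_nat m) - beta_diff 1 (1 + of_nat m))) = (\<lambda>m. beta_diff 1 s)"
    using beta_diff_1_shift_nat[OF s] beta_diff_1_shift_nat[of 1]
    by (simp add: beta_diff_def)
  finally show ?thesis by (simp add: LIMSEQ_const_iff Digamma_1)
qed

section \<open>The compensated Beta integral\<close>

text \<open>
  The compensator \<open>exp(-x) - exp(-2 x)\<close> is \<open>exp(-x) w\<close>. Unlike the truncation
  \<open>x 1(x < 1)\<close> it is a combination of exponentials, which is what keeps the integral explicit.
\<close>
definition compensated_integral :: "real \<Rightarrow> complex \<Rightarrow> complex \<Rightarrow> complex" where
  "compensated_integral \<alpha> r s = (CLINT x:{0<..}|lborel.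
     (exp (- (r * of_real x)) - exp (- (s * of_real x)) + (r - s) * (exp (- of_real x) - exp (- (2 * of_real x))))
       * w_powr (- \<alpha> - 1) x)"

text \<open>
  Here \<open>h\<close> is the numerator of the compensated integral, \<open>h'\<close> its derivative and \<open>\<delta>\<close> a
  decay rate common to all the exponentials in them.
\<close>
context
  fixes \<alpha> :: real and r s :: complex and h h' :: "real \<Rightarrow> complex" and \<delta> :: real
  assumes \<alpha>: "\<alpha> < 2" and r: "Re r > 0" and s: "Re s > 0"
  defines "h \<equiv> \<lambda>x. exp (- (r * of_real x)) - exp (- (s * of_real x)) + (r - s) * (exp (- of_real x) - exp (- (2 * of_real x)))"
  and "h' \<equiv> \<lambda>x. s * exp (- (s * of_real x)) - r * exp (- (r * of_real x)) + (r - s) * (2 * exp (- (2 * of_real x)) - exp (- of_real x))"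
  and "\<delta> \<equiv> min 1 (min (Re r) (Re s))"
begin

text \<open>
  Writing each exponential as \<open>1 - z x\<close> plus a Taylor remainder, the constant and the linear
  terms of \<open>h\<close> cancel.
\<close>
lemma compensated_bigo_at_0: "h \<in> O[at_right 0](\<lambda>x. of_real (x powr 2))"
proof -
  define T where "T = (\<lambda>z x. exp (- z * of_real x) - 1 - (- z) * complex_of_real x)"
  have T: "T z \<in> O[at_right 0](\<lambda>x. of_real (x powr 2))" for z
    unfolding T_def by (rule exp_minus_one_bigo(2))
  have "(\<lambda>x. T r x - T s x + (r - s) * (T 1 x - T 2 x)) \<in> O[at_right 0](\<lambda>x. of_real (x powr 2))"
    by (intro sum_in_bigo bigo_cmult T)
  also have "(\<lambda>x. T r x - T s x + (r - s) * (T 1 x - T 2 x)) = h"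
    by (rule ext) (simp add: T_def h_def algebra_simps)
  finally show ?thesis .
qed

lemma compensated_deriv_bigo_at_0: "h' \<in> O[at_right 0](\<lambda>x. of_real (x powr (2 - 1)))"
proof -
  define T where "T = (\<lambda>z x. exp (- z * complex_of_real x) - 1)"
  have T: "T z \<in> O[at_right 0](\<lambda>x. of_real (x powr (2 - 1)))" for z
    unfolding T_def using exp_minus_one_bigo(1)[of "-z"] by simp
  have "(\<lambda>x. s * T s x - r * T r x + (r - s) * (2 * T 2 x - T 1 x)) \<in> O[at_right 0](\<lambda>x. of_real (x powr (2 - 1)))"
    by (intro sum_in_bigo bigo_cmult T)
  also have "(\<lambda>x. s * T s x - r * T r x + (r - s) * (2 * T 2 x - T 1 x)) = h'"
    by (rule ext) (simp add: T_def h'_def algebra_simps)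
  finally show ?thesis .
qed

lemma compensated_bigo_at_top: "h \<in> O(\<lambda>x. of_real (exp (- (\<delta> * x))))"
  unfolding h_def
  using exp_bigo_at_top[of \<delta> 1] exp_bigo_at_top[of \<delta> r] exp_bigo_at_top[of \<delta> s] exp_bigo_at_top[of \<delta> 2]
  by (intro sum_in_bigo bigo_cmult) (auto simp: \<delta>_def)

lemma compensated_deriv_bigo_at_top: "h' \<in> O(\<lambda>x. of_real (exp (- (\<delta> * x))))"
  unfolding h'_def
  using exp_bigo_at_top[of \<delta> 1] exp_bigo_at_top[of \<delta> r] exp_bigo_at_top[of \<delta> s] exp_bigo_at_top[of \<delta> 2]
  by (intro sum_in_bigo bigo_cmult) (auto simp: \<delta>_def)

lemma compensated_integrable: "set_integrable lborel {0<..} (\<lambda>x. h x * w_powr (- \<alpha> - 1) x)"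
  using \<alpha> r s
  by (intro set_integrable_half_line_powr[OF _ compensated_bigo_at_0 _ compensated_bigo_at_top])
     (auto simp: h_def \<delta>_def intro!: continuous_intros)

text \<open>
  Integration by parts with a double zero (\<open>m = 2\<close>, \<open>b = -\<alpha>\<close>). The coefficients of \<open>h' + \<alpha> h\<close>
  add up to zero, so it is a combination of differences \<open>exp(-x) - exp(-z x)\<close> with
  \<open>z = r, s, 2\<close>; the one with \<open>z = 2\<close> has integral \<open>1 / (2 - \<alpha>)\<close> and contributes \<open>-(r - s)\<close>.
\<close>
lemma compensated_integral_by_parts:
  "of_real \<alpha> * compensated_integral \<alpha> r s =
     (of_real \<alpha> - s) * beta_diff \<alpha> s - (of_real \<alpha> - r) * beta_diff \<alpha> r - (r - s)"
proof -
  have "- of_real (- \<alpha>) * (CLINT x:{0<..}|lborel. h x * w_powr (- \<alpha> - 1) x) =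
        (CLINT x:{0<..}|lborel. (h' x - of_real (- \<alpha>) * h x) * w_powr (- \<alpha>) x)"
  proof (rule integral_by_parts_powr[OF _ _ compensated_bigo_at_0 compensated_deriv_bigo_at_0 compensated_bigo_at_top compensated_deriv_bigo_at_top])
    show "(h has_vector_derivative h' x) (at x)" for x
      unfolding h_def h'_def
      by (auto intro!: derivative_eq_intros has_vector_derivative_real_field simp: algebra_simps)
  qed (use \<alpha> r s in \<open>auto simp: h'_def \<delta>_def intro!: continuous_intros\<close>)
  also have "\<dots> = (CLINT x:{0<..}|lborel.
       (of_real \<alpha> - s) * ((exp (- of_real x) - exp (- (s * of_real x))) * w_powr (- \<alpha>) x)
       - (of_real \<alpha> - r) * ((exp (- of_real x) - exp (- (r * of_real x))) * w_powr (- \<alpha>) x)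
       - (r - s) * of_real (2 - \<alpha>) * ((exp (- of_real x) - exp (- (2 * of_real x))) * w_powr (- \<alpha>) x))"
    by (intro set_lebesgue_integral_cong) (auto simp: algebra_simps h_def h'_def)
  also have "\<dots> = (CLINT x:{0<..}|lborel.
       (of_real \<alpha> - s) * ((exp (- of_real x) - exp (- (s * of_real x))) * w_powr (- \<alpha>) x)
       - (of_real \<alpha> - r) * ((exp (- of_real x) - exp (- (r * of_real x))) * w_powr (- \<alpha>) x))
       - (CLINT x:{0<..}|lborel. (r - s) * of_real (2 - \<alpha>) * ((exp (- of_real x) - exp (- (2 * of_real x))) * w_powr (- \<alpha>) x))"
    using \<alpha> r s
    by (intro set_integral_diff set_integrable_mult_right beta_diff_integrable) auto
  also have "(CLINT x:{0<..}|lborel.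
       (of_real \<alpha> - s) * ((exp (- of_real x) - exp (- (s * of_real x))) * w_powr (- \<alpha>) x)
       - (of_real \<alpha> - r) * ((exp (- of_real x) - exp (- (r * of_real x))) * w_powr (- \<alpha>) x))
     = (CLINT x:{0<..}|lborel.
       (of_real \<alpha> - s) * ((exp (- of_real x) - exp (- (s * of_real x))) * w_powr (- \<alpha>) x))
       - (CLINT x:{0<..}|lborel. (of_real \<alpha> - r) * ((exp (- of_real x) - exp (- (r * of_real x))) * w_powr (- \<alpha>) x))"
    using \<alpha> r s
    by (intro set_integral_diff set_integrable_mult_right beta_diff_integrable) auto
  finally have "of_real \<alpha> * compensated_integral \<alpha> r s =
     (of_real \<alpha> - s) * beta_diff \<alpha> s - (of_real \<alpha> - r) * beta_diff \<alpha> r - (r - s) * of_real (2 - \<alpha>) * beta_diff \<alpha> 2"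
    unfolding set_integral_mult_right compensated_integral_def h_def beta_diff_def by simp
  moreover have "complex_of_real (2 - \<alpha>) \<noteq> 0" using \<alpha> by (subst of_real_eq_0_iff) simp
  ultimately show ?thesis by (simp only: beta_diff_2[OF \<alpha>]) simp
qed

text \<open>
  The factors \<open>\<alpha> - s\<close> and \<open>\<alpha> - r\<close> from the integration by parts are absorbed by
  \<open>1/\<Gamma>(z + 1 - \<alpha>)\<close>, and the factor \<open>\<alpha>\<close> by \<open>\<Gamma>(1 - \<alpha>)\<close>.
\<close>
theorem compensated_integral_eq_Gamma:
  assumes "0 < \<alpha>" "\<alpha> \<noteq> 1"
  shows "compensated_integral \<alpha> r s = - (r - s) / of_real (\<alpha> - 1)
     - Gamma (of_real (- \<alpha>)) * (Gamma s * rGamma (s - of_real \<alpha>) - Gamma r * rGamma (r - of_real \<alpha>))"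
proof -
  define A :: complex where "A = of_real \<alpha>"
  have nz: "A \<noteq> 0" "1 - A \<noteq> 0" "A - 1 \<noteq> 0" using assms by (auto simp: A_def complex_eq_iff)
  have "- A \<notin> \<int>\<^sub>\<le>\<^sub>0"
  proof
    assume "- A \<in> \<int>\<^sub>\<le>\<^sub>0"
    then obtain n where "- A = - of_nat n" by (auto elim!: nonpos_Ints_cases')
    then have "\<alpha> = real n" by (simp add: A_def complex_eq_iff)
    then show False using assms \<alpha> by auto
  qed
  then have G: "Gamma (1 - A) = - A * Gamma (- A)"
    using Gamma_plus1[of "- A"] by simp
  have rG: "(z - A) * rGamma (z + (1 - A)) = rGamma (z - A)" for z
    using rGamma_plus1[of "z - A"] by (simp add: algebra_simps)
  have D: "beta_diff \<alpha> z = 1 / (1 - A) + A * Gamma z * Gamma (- A) * rGamma (z + (1 - A))" if "Re z > 0" for z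
    using beta_diff_eq_Gamma[of z \<alpha>] that \<alpha> assms by (simp add: A_def[symmetric] G)
  have "A * compensated_integral \<alpha> r s = (A - s) * beta_diff \<alpha> s - (A - r) * beta_diff \<alpha> r - (r - s)"
    using compensated_integral_by_parts by (simp add: A_def)
  also have "\<dots> = (r - s) / (1 - A) - (r - s)
      - A * Gamma (- A) * (Gamma s * ((s - A) * rGamma (s + (1 - A))) - Gamma r * ((r - A) * rGamma (r + (1 - A))))"
    unfolding D[OF r] D[OF s] diff_divide_distrib by (simp add: algebra_simps add_divide_distrib diff_divide_distrib)
  also have "(r - s) / (1 - A) - (r - s) = A * (- (r - s) / (A - 1))"
    using nz by (simp add: field_simps)
  finally have "A * compensated_integral \<alpha> r s = A * (- (r - s) / (A - 1) - Gamma (- A) * (Gamma s * rGamma (s - A) - Gamma r * rGamma (r - A)))"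
    unfolding rG by (simp add: algebra_simps)
  then show ?thesis using nz by (simp add: A_def)
qed

theorem compensated_integral_eq_Digamma:
  assumes "\<alpha> = 1"
  shows "compensated_integral \<alpha> r s = - (r - s) * (1 - euler_mascheroni)
     - ((s - 1) * Digamma s - (r - 1) * Digamma r)"
  using compensated_integral_by_parts assms r s
  by (simp add: beta_diff_1_eq_Digamma algebra_simps)

end

section \<open>The integral of one half of the Levy measure\<close>

definition lamperti_density :: "real \<Rightarrow> real \<Rightarrow> real \<Rightarrow> real" where
  "lamperti_density \<alpha> \<kappa> x = exp (\<kappa> * x) / (exp x - 1) powr (\<alpha> + 1)"

text \<open>
  In this form the density is an exponential times a power of \<open>w\<close>, as in the Beta integrals.
\<close>
lemma lamperti_density_altdef:
  assumes "x > 0"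
  shows "lamperti_density \<alpha> \<kappa> x = exp (- ((\<alpha> + 1 - \<kappa>) * x)) * (1 - exp (-x)) powr (- \<alpha> - 1)"
proof -
  have "exp x - 1 = exp x * (1 - exp (-x))" by (simp add: algebra_simps exp_add[symmetric])
  then have "(exp x - 1) powr (\<alpha> + 1) = exp ((\<alpha> + 1) * x) * (1 - exp (-x)) powr (\<alpha> + 1)"
    using assms by (simp add: powr_mult exp_powr_real mult_ac)
  moreover have "(1 - exp (-x)) powr (- \<alpha> - 1) = inverse ((1 - exp (-x)) powr (\<alpha> + 1))"
    unfolding powr_minus[symmetric] by simp
  moreover have "exp (- ((\<alpha> + 1 - \<kappa>) * x)) = exp (\<kappa> * x) * inverse (exp ((\<alpha> + 1) * x))"
    unfolding exp_minus[symmetric] exp_add[symmetric] by (simp add: algebra_simps)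
  ultimately show ?thesis
    by (simp add: lamperti_density_def divide_inverse)
qed

lemma lamperti_density_measurable [measurable]: "lamperti_density \<alpha> \<kappa> \<in> borel_measurable borel"
  unfolding lamperti_density_def[abs_def] by measurable

lemma set_integral_insert:
  fixes f :: "real \<Rightarrow> 'b :: {banach, second_countable_topology}"
  shows "(LINT x:insert a S|lborel. f x) = (LINT x:S|lborel. f x)"
  unfolding set_lebesgue_integral_def
  by (rule integral_discrete_difference[where X = "{a}"]) (auto simp: indicator_def)

lemma set_integrable_of_real_iff:
  "set_integrable M A (\<lambda>x. complex_of_real (f x)) \<longleftrightarrow> set_integrable M A f"
  using complex_of_real_integrable_eq[of M "\<lambda>x. indicator A x *\<^sub>R f x"]
  by (simp add: set_integrable_def scaleR_conv_of_real)

lemma x_exp_bigo_at_top: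
  assumes "\<delta> > 0" "f \<in> O(\<lambda>x. complex_of_real (exp (- (\<delta> * x))))"
  shows "(\<lambda>x. of_real x * f x) \<in> O(\<lambda>x. complex_of_real (exp (- (\<delta> / 2 * x))))"
proof -
  have "(\<lambda>x. of_real x * f x) \<in> O(\<lambda>x. complex_of_real x * complex_of_real (exp (- (\<delta> * x))))"
    using assms(2) by (intro landau_o.big.mult_left)
  also have "(\<lambda>x. complex_of_real x * complex_of_real (exp (- (\<delta> * x)))) \<in> O(\<lambda>x. complex_of_real (exp (- (\<delta> / 2 * x))))"
    unfolding of_real_mult[symmetric] landau_o.big.of_real_iff
    using assms(1) by real_asymp
  finally show ?thesis .
qed

lemma x_bigo_at_0:
  assumes "f \<in> O[at_right 0](\<lambda>x. complex_of_real (x powr p))"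
  shows "(\<lambda>x. of_real x * f x) \<in> O[at_right 0](\<lambda>x. complex_of_real (x powr (1 + p)))"
proof -
  have "(\<lambda>x. complex_of_real x) \<in> O[at_right 0](\<lambda>x. complex_of_real (x powr 1))"
    unfolding landau_o.big.of_real_iff by real_asymp
  from landau_o.big.mult[OF this assms] show ?thesis by (simp add: powr_add)
qed

text \<open>
  The difference between the two compensators, \<open>exp(-x) w\<close> taken against
  \<open>w powr (-\<alpha> - 1)\<close> and \<open>x 1(x < 1)\<close> taken against the density.
\<close>
definition lamperti_const_integrand :: "real \<Rightarrow> real \<Rightarrow> real \<Rightarrow> real" where
  "lamperti_const_integrand \<alpha> \<kappa> x = exp (-x) * (1 - exp (-x)) powr (- \<alpha>)
     - x * indicator {..<1} x * lamperti_density \<alpha> \<kappa> x"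

text \<open>
  On \<open>(0, 1)\<close> the difference of the compensators splits into the first two integrands of
  \<open>lamperti_const\<close> by adding and subtracting \<open>x exp(-x)\<close>; each of them is of order
  \<open>x powr (1 - \<alpha>)\<close> at \<open>0\<close>. On \<open>[1, \<infinity>)\<close> the truncated term is absent.
\<close>
lemma lamperti_const_eq:
  assumes \<alpha>: "\<alpha> < 2" and \<kappa>: "\<kappa> < \<alpha> + 1"
  shows "set_integrable lborel {0<..} (lamperti_const_integrand \<alpha> \<kappa>)"
    and "(LINT x:{0<..}|lborel. lamperti_const_integrand \<alpha> \<kappa> x) = lamperti_const \<alpha> \<kappa>"
proof -
  let ?w = "\<lambda>x::real. 1 - exp (-x)"
  define f1 where "f1 = (\<lambda>x. x * exp (-x) * (1 - exp (- ((\<alpha> - \<kappa>) * x))) / ?w x powr (\<alpha> + 1))"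
  define f2 where "f2 = (\<lambda>x. exp (-x) * ((1 - x - exp (-x)) / ?w x powr (\<alpha> + 1)))"
  define f3 where "f3 = (\<lambda>x. exp (-x) / ?w x powr \<alpha>)"
  have powr: "inverse (?w x powr (\<alpha> + 1)) = ?w x powr (- \<alpha> - 1)" for x
    unfolding powr_minus[symmetric] by simp
  define r where "r = complex_of_real (\<alpha> + 1 - \<kappa>)"
  define \<delta> where "\<delta> = min 1 (Re r)"
  have \<delta>: "\<delta> > 0" "Re r > 0" using \<kappa> by (auto simp: \<delta>_def r_def)

  have "set_integrable lborel {0<..} (\<lambda>x. of_real x * (exp (- of_real x) - exp (- (r * of_real x))) * w_powr (- \<alpha> - 1) x)"
    using \<alpha> \<delta>
    by (intro set_integrable_half_line_powr[OF _ x_bigo_at_0[OF exp_diff_bigo_at_0] _ x_exp_bigo_at_top[OF \<delta>(1) exp_diff_bigo_at_top[OF \<delta>(2) \<delta>_def]]])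
       (auto intro!: continuous_intros)
  also have "(\<lambda>x. of_real x * (exp (- of_real x) - exp (- (r * of_real x))) * w_powr (- \<alpha> - 1) x) = (\<lambda>x. complex_of_real (f1 x))"
  proof
    fix x
    have "exp (- ((\<alpha> + 1 - \<kappa>) * x)) = exp (-x) * exp (- ((\<alpha> - \<kappa>) * x))"
      unfolding exp_add[symmetric] by (simp add: algebra_simps)
    then have "f1 x = x * (exp (-x) - exp (- ((\<alpha> + 1 - \<kappa>) * x))) * ?w x powr (- \<alpha> - 1)"
      unfolding f1_def divide_inverse powr by (simp add: algebra_simps)
    then show "of_real x * (exp (- of_real x) - exp (- (r * of_real x))) * w_powr (- \<alpha> - 1) x = complex_of_real (f1 x)"
      by (simp add: r_def exp_of_real[symmetric])
  qed
  finally have f1: "set_integrable lborel {0<..} f1" by (simp only: set_integrable_of_real_iff)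

  have "set_integrable lborel {0<..} (\<lambda>x. exp (- (1 * of_real x)) * (1 - of_real x - exp (- of_real x)) * w_powr (- \<alpha> - 1) x)"
  proof (rule set_integrable_half_line_powr)
    have "(\<lambda>x. exp (- (1 * complex_of_real x)) * ((-1) * (exp (- 1 * of_real x) - 1 - (- 1) * of_real x)))
        \<in> O[at_right 0](\<lambda>x. of_real (x powr 0) * of_real (x powr 2))"
      by (intro landau_o.big.mult exp_bigo_at_0 bigo_cmult exp_minus_one_bigo(2))
    then show "(\<lambda>x. exp (- (1 * complex_of_real x)) * (1 - of_real x - exp (- of_real x))) \<in> O[at_right 0](\<lambda>x. of_real (x powr (0 + 2)))"
      by (simp only: powr_add of_real_mult) (simp add: algebra_simps)
    have "(\<lambda>x::real. exp (-x) * (1 - x - exp (-x))) \<in> O(\<lambda>x. exp (- (1/2 * x)))" by real_asymp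
    then have "(\<lambda>x::real. complex_of_real (exp (-x) * (1 - x - exp (-x)))) \<in> O(\<lambda>x. of_real (exp (- (1/2 * x))))"
      by (simp only: landau_o.big.of_real_iff)
    then show "(\<lambda>x. exp (- (1 * complex_of_real x)) * (1 - of_real x - exp (- of_real x))) \<in> O(\<lambda>x. of_real (exp (- (1/2 * x))))"
      by (simp add: exp_of_real[symmetric])
  qed (use \<alpha> in \<open>auto intro!: continuous_intros\<close>)
  also have "(\<lambda>x. exp (- (1 * complex_of_real x)) * (1 - of_real x - exp (- of_real x)) * w_powr (- \<alpha> - 1) x) = (\<lambda>x. complex_of_real (f2 x))"
    by (rule ext) (simp add: f2_def divide_inverse powr exp_of_real[symmetric])
  finally have f2: "set_integrable lborel {0<..} f2" by (simp only: set_integrable_of_real_iff)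

  \<comment> \<open>For \<open>\<alpha> \<ge> 1\<close> the function \<open>f3\<close> is not integrable at \<open>0\<close>; away from \<open>0\<close> it is comparable to the
      integrand of the convergent Beta integral \<open>B(1, 3 - \<alpha>)\<close>.\<close>
  have f3: "set_integrable lborel {1..} f3"
  proof (rule set_integrable_bound)
    have "set_integrable lborel {0<..} (\<lambda>x. complex_of_real (exp (-x) * ?w x powr (3 - \<alpha> - 1)))"
      using beta_integrable[of 1 "3 - \<alpha>"] \<alpha> by (simp add: exp_of_real[symmetric])
    then have "set_integrable lborel {0<..} (\<lambda>x. exp (-x) * ?w x powr (3 - \<alpha> - 1))"
      by (simp only: set_integrable_of_real_iff)
    then have "set_integrable lborel {1..} (\<lambda>x. exp (-x) * ?w x powr (3 - \<alpha> - 1))"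
      by (rule set_integrable_subset) auto
    then show "set_integrable lborel {1..} (\<lambda>x. inverse (?w 1) powr 2 * (exp (-x) * ?w x powr (3 - \<alpha> - 1)))"
      by (rule set_integrable_mult_right)
    show "set_borel_measurable lborel {1..} f3"
      unfolding set_borel_measurable_def f3_def by measurable
    show "AE x\<in>{1..} in lborel. norm (f3 x) \<le> norm (inverse (?w 1) powr 2 * (exp (-x) * ?w x powr (3 - \<alpha> - 1)))"
    proof (intro AE_I2 impI)
      fix x :: real assume x: "x \<in> {1..}"
      have w: "?w x > 0" "?w 1 > 0" "?w 1 \<le> ?w x" using x by auto
      have "?w x powr (3 - \<alpha> - 1) = ?w x powr 2 * ?w x powr (- \<alpha>)"
        unfolding powr_add[symmetric] by simp
      moreover have "1 \<le> inverse (?w 1) powr 2 * ?w x powr 2"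
        using w by (simp add: powr_mult[symmetric] field_simps ge_one_powr_ge_zero)
      ultimately have "1 * (exp (-x) * ?w x powr (- \<alpha>)) \<le> (inverse (?w 1) powr 2 * ?w x powr 2) * (exp (-x) * ?w x powr (- \<alpha>))"
        by (intro mult_right_mono) auto
      also have "\<dots> = inverse (?w 1) powr 2 * (exp (-x) * ?w x powr (3 - \<alpha> - 1))"
        using \<open>?w x powr (3 - \<alpha> - 1) = _\<close> by simp
      finally show "norm (f3 x) \<le> norm (inverse (?w 1) powr 2 * (exp (-x) * ?w x powr (3 - \<alpha> - 1)))"
        by (simp add: f3_def divide_inverse powr_minus[symmetric] abs_mult)
    qed
  qed

  have small: "lamperti_const_integrand \<alpha> \<kappa> x = f1 x + f2 x" if x: "0 < x" "x < 1" for x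
  proof -
    have "?w x powr (- \<alpha>) = ?w x powr 1 * ?w x powr (- \<alpha> - 1)"
      unfolding powr_add[symmetric] by simp
    then have 1: "?w x powr (- \<alpha>) = ?w x * ?w x powr (- \<alpha> - 1)" using x by simp
    have 2: "exp (- ((\<alpha> + 1 - \<kappa>) * x)) = exp (-x) * exp (- ((\<alpha> - \<kappa>) * x))"
      unfolding exp_add[symmetric] by (simp add: algebra_simps)
    show ?thesis using x
      unfolding lamperti_const_integrand_def lamperti_density_altdef[OF x(1)] 1 2 f1_def f2_def divide_inverse powr
      by (simp add: algebra_simps)
  qed
  have large: "lamperti_const_integrand \<alpha> \<kappa> x = f3 x" if x: "x \<ge> 1" for x
    using x by (simp add: lamperti_const_integrand_def f3_def divide_inverse powr_minus[symmetric])
  have f1': "set_integrable lborel {0<..<1} f1" and f2': "set_integrable lborel {0<..<1} f2"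
    using f1 f2 by (auto elim: set_integrable_subset)
  have "set_integrable lborel {0<..<1} (\<lambda>x. f1 x + f2 x)" using f1' f2' by (rule set_integral_add)
  also have "?this \<longleftrightarrow> set_integrable lborel {0<..<1} (lamperti_const_integrand \<alpha> \<kappa>)"
    by (rule set_integrable_cong) (auto simp: small)
  finally have int1: "set_integrable lborel {0<..<1} (lamperti_const_integrand \<alpha> \<kappa>)" .
  have int2: "set_integrable lborel {1..} (lamperti_const_integrand \<alpha> \<kappa>)"
    using f3 by (subst set_integrable_cong[OF refl refl, where f' = f3]) (auto simp: large)
  have Un: "{0<..} = {0<..<1} \<union> {1::real..}" by auto
  show "set_integrable lborel {0<..} (lamperti_const_integrand \<alpha> \<kappa>)"
    unfolding Un using int1 int2 by (intro set_integrable_Un) auto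
  have "(LINT x:{0<..}|lborel. lamperti_const_integrand \<alpha> \<kappa> x) =
    (LINT x:{0<..<1}|lborel. lamperti_const_integrand \<alpha> \<kappa> x) + (LINT x:{1..}|lborel. lamperti_const_integrand \<alpha> \<kappa> x)"
    unfolding Un by (intro set_integral_Un int1 int2) auto
  also have "(LINT x:{0<..<1}|lborel. lamperti_const_integrand \<alpha> \<kappa> x) = (LINT x:{0<..<1}|lborel. f1 x + f2 x)"
    by (intro set_lebesgue_integral_cong) (auto simp: small)
  also have "\<dots> = (LINT x:{0<..<1}|lborel. f1 x) + (LINT x:{0<..<1}|lborel. f2 x)"
    using f1' f2' by (rule set_integral_add)
  also have "(LINT x:{1..}|lborel. lamperti_const_integrand \<alpha> \<kappa> x) = (LINT x:{1..}|lborel. f3 x)"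
    by (intro set_lebesgue_integral_cong) (auto simp: large)
  also have "{1..} = insert 1 {1::real<..}" by auto
  also have "(LINT x:insert 1 {1<..}|lborel. f3 x) = (LINT x:{1<..}|lborel. f3 x)"
    by (rule set_integral_insert)
  finally show "(LINT x:{0<..}|lborel. lamperti_const_integrand \<alpha> \<kappa> x) = lamperti_const \<alpha> \<kappa>"
    by (simp add: lamperti_const_def f1_def f2_def f3_def)
qed

text \<open>
  For \<open>\<alpha> < 1\<close> both compensators are integrable, so their difference can be separated. This
  links the drift coefficient to \<open>lamperti_const\<close>.
\<close>
lemma small_jumps_less_1:
  assumes \<alpha>: "\<alpha> < 1" and \<kappa>: "\<kappa> < \<alpha> + 1"
  shows "set_integrable lborel {0<..} (\<lambda>x. lamperti_density \<alpha> \<kappa> x * (x * indicator {..<1} x))"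
    and "(LINT x:{0<..}|lborel. lamperti_density \<alpha> \<kappa> x * (x * indicator {..<1} x)) = 1 / (1 - \<alpha>) - lamperti_const \<alpha> \<kappa>"
proof -
  let ?w = "\<lambda>x::real. 1 - exp (-x)"
  have c: "complex_of_real (exp (-x) * ?w x powr (- \<alpha>)) = exp (- (1 * of_real x)) * w_powr (1 - \<alpha> - 1) x" for x
    by (simp add: exp_of_real[symmetric])
  have int: "set_integrable lborel {0<..} (\<lambda>x. exp (-x) * ?w x powr (- \<alpha>))"
    unfolding set_integrable_of_real_iff[symmetric] c
    using \<alpha> by (intro beta_integrable) auto
  have eq: "lamperti_density \<alpha> \<kappa> x * (x * indicator {..<1} x) = exp (-x) * ?w x powr (- \<alpha>) - lamperti_const_integrand \<alpha> \<kappa> x" for x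
    by (simp add: lamperti_const_integrand_def)
  have "complex_of_real (LINT x:{0<..}|lborel. exp (-x) * ?w x powr (- \<alpha>)) = beta_integral 1 (1 - \<alpha>)"
    unfolding set_integral_complex_of_real[symmetric] c beta_integral_def ..
  also have "\<dots> = of_real (1 / (1 - \<alpha>))" using \<alpha> by (simp add: beta_integral_1)
  finally have val: "(LINT x:{0<..}|lborel. exp (-x) * ?w x powr (- \<alpha>)) = 1 / (1 - \<alpha>)"
    by (simp only: of_real_eq_iff)
  have A: "set_integrable lborel {0<..} (lamperti_const_integrand \<alpha> \<kappa>)"
    "(LINT x:{0<..}|lborel. lamperti_const_integrand \<alpha> \<kappa> x) = lamperti_const \<alpha> \<kappa>"
    using \<alpha> \<kappa> by (intro lamperti_const_eq; simp)+
  show "set_integrable lborel {0<..} (\<lambda>x. lamperti_density \<alpha> \<kappa> x * (x * indicator {..<1} x))"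
    unfolding eq by (intro set_integral_diff int A)
  show "(LINT x:{0<..}|lborel. lamperti_density \<alpha> \<kappa> x * (x * indicator {..<1} x)) = 1 / (1 - \<alpha>) - lamperti_const \<alpha> \<kappa>"
    unfolding eq by (subst set_integral_diff(2)[OF int A(1)]) (simp only: val A(2))
qed

text \<open>
  Replacing the truncation by the exponential compensator changes the integral by \<open>i y\<close> times
  the constant, and \<open>exp(i y x)\<close> shifts the exponent \<open>r\<close> of the density to \<open>s = r - i y\<close>.
\<close>
lemma half_line_exponent:
  fixes y :: real
  assumes \<alpha>: "\<alpha> < 2" and \<kappa>: "\<kappa> < \<alpha> + 1"
  defines "F \<equiv> \<lambda>x. 1 - iexp (y * x) + \<i> * y * x * indicator {x. \<bar>x\<bar> < 1} x"
  shows "set_integrable lborel {0<..} (\<lambda>x. lamperti_density \<alpha> \<kappa> x *\<^sub>R F x)"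
    and "(CLINT x:{0<..}|lborel. lamperti_density \<alpha> \<kappa> x *\<^sub>R F x) =
      compensated_integral \<alpha> (of_real (\<alpha> + 1 - \<kappa>)) (of_real (\<alpha> + 1 - \<kappa>) - \<i> * y) - \<i> * y * lamperti_const \<alpha> \<kappa>"
proof -
  define r where "r = complex_of_real (\<alpha> + 1 - \<kappa>)"
  define s where "s = r - \<i> * y"
  have r: "Re r > 0" and s: "Re s > 0" using \<kappa> by (auto simp: r_def s_def)
  define h where "h = (\<lambda>x. exp (- (r * of_real x)) - exp (- (s * of_real x)) + (r - s) * (exp (- of_real x) - exp (- (2 * complex_of_real x))))"
  have int_h: "set_integrable lborel {0<..} (\<lambda>x. h x * w_powr (- \<alpha> - 1) x)"
    unfolding h_def by (rule compensated_integrable[OF \<alpha> r s])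
  have int_A: "set_integrable lborel {0<..} (\<lambda>x. \<i> * y * complex_of_real (lamperti_const_integrand \<alpha> \<kappa> x))"
    using lamperti_const_eq(1)[OF \<alpha> \<kappa>]
    by (intro set_integrable_mult_right) (simp only: set_integrable_of_real_iff)
  have eq: "lamperti_density \<alpha> \<kappa> x *\<^sub>R F x = h x * w_powr (- \<alpha> - 1) x - \<i> * y * complex_of_real (lamperti_const_integrand \<alpha> \<kappa> x)"
    if x: "x > 0" for x
  proof -
    let ?w = "1 - exp (-x)"
    have "?w powr (- \<alpha>) = ?w powr 1 * ?w powr (- \<alpha> - 1)"
      unfolding powr_add[symmetric] by simp
    then have 1: "?w powr (- \<alpha>) = ?w * ?w powr (- \<alpha> - 1)" using x by simp
    have 2: "exp (- (r * of_real x)) = complex_of_real (exp (- ((\<alpha> + 1 - \<kappa>) * x)))"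
      by (simp add: r_def exp_of_real[symmetric])
    have 3: "exp (- (s * of_real x)) = complex_of_real (exp (- ((\<alpha> + 1 - \<kappa>) * x))) * iexp (y * x)"
      unfolding 2[symmetric] exp_add[symmetric] s_def by (simp add: algebra_simps)
    have 4: "exp (- (2 * complex_of_real x)) = of_real (exp (-x)) * of_real (exp (-x))"
       "exp (- complex_of_real x) = of_real (exp (-x))"
      unfolding exp_of_real[symmetric] exp_add[symmetric] by simp_all
    have 5: "r - s = \<i> * y" by (simp add: s_def)
    have 6: "indicator {x. \<bar>x\<bar> < 1} x = complex_of_real (indicator {..<1} x)"
      using x by (simp add: indicator_def)
    show ?thesis
      unfolding h_def F_def lamperti_const_integrand_def lamperti_density_altdef[OF x] 1 2 3 4 5 6
      by (simp add: scaleR_conv_of_real algebra_simps)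
  qed
  have "set_integrable lborel {0<..} (\<lambda>x. h x * w_powr (- \<alpha> - 1) x - \<i> * y * complex_of_real (lamperti_const_integrand \<alpha> \<kappa> x))"
    by (intro set_integral_diff int_h int_A)
  also have "?this \<longleftrightarrow> set_integrable lborel {0<..} (\<lambda>x. lamperti_density \<alpha> \<kappa> x *\<^sub>R F x)"
    by (intro set_integrable_cong) (auto simp: eq)
  finally show "set_integrable lborel {0<..} (\<lambda>x. lamperti_density \<alpha> \<kappa> x *\<^sub>R F x)" .
  have "(CLINT x:{0<..}|lborel. lamperti_density \<alpha> \<kappa> x *\<^sub>R F x) = 
     (CLINT x:{0<..}|lborel. h x * w_powr (- \<alpha> - 1) x - \<i> * y * complex_of_real (lamperti_const_integrand \<alpha> \<kappa> x))"
    by (intro set_lebesgue_integral_cong) (auto simp: eq)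
  also have "\<dots> = (CLINT x:{0<..}|lborel. h x * w_powr (- \<alpha> - 1) x) - (CLINT x:{0<..}|lborel. \<i> * y * complex_of_real (lamperti_const_integrand \<alpha> \<kappa> x))"
    by (intro set_integral_diff int_h int_A)
  also have "(CLINT x:{0<..}|lborel. h x * w_powr (- \<alpha> - 1) x) = compensated_integral \<alpha> r s"
    by (simp add: compensated_integral_def h_def)
  also have "(CLINT x:{0<..}|lborel. \<i> * y * complex_of_real (lamperti_const_integrand \<alpha> \<kappa> x)) = \<i> * y * lamperti_const \<alpha> \<kappa>"
    unfolding set_integral_mult_right set_integral_complex_of_real lamperti_const_eq(2)[OF \<alpha> \<kappa>] ..
  finally show "(CLINT x:{0<..}|lborel. lamperti_density \<alpha> \<kappa> x *\<^sub>R F x) =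
      compensated_integral \<alpha> (of_real (\<alpha> + 1 - \<kappa>)) (of_real (\<alpha> + 1 - \<kappa>) - \<i> * y) - \<i> * y * lamperti_const \<alpha> \<kappa>"
    by (simp only: r_def s_def)
qed

section \<open>The characteristic exponent\<close>

lemma lamperti_levy_measure_integral:
  fixes F :: "real \<Rightarrow> 'b :: {banach, second_countable_topology}"
  assumes F [measurable]: "F \<in> borel_measurable borel"
    and pos: "set_integrable lborel {0<..} (\<lambda>x. lamperti_density \<alpha> (f 1) x *\<^sub>R F x)"
    and neg: "set_integrable lborel {0<..} (\<lambda>x. lamperti_density \<alpha> (f (-1)) x *\<^sub>R F (-x))"
  shows "(LINT x:-{0}|lamperti_levy_measure \<alpha> f \<sigma>. F x) =
     measure \<sigma> {1} *\<^sub>R (LINT x:{0<..}|lborel. lamperti_density \<alpha> (f 1) x *\<^sub>R F x) +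
     measure \<sigma> {-1} *\<^sub>R (LINT x:{0<..}|lborel. lamperti_density \<alpha> (f (-1)) x *\<^sub>R F (-x))"
proof -
  define g where "g = (\<lambda>x::real. 
     if x > 0 then measure \<sigma> {1} * exp (f 1 * x) / (exp x - 1) powr (\<alpha> + 1)
     else if x < 0 then measure \<sigma> {-1} * exp (- (f (-1) * x)) / (exp (-x) - 1) powr (\<alpha> + 1)
     else 0)"
  have [measurable]: "g \<in> borel_measurable borel" unfolding g_def by measurable
  have g_nonneg: "g x \<ge> 0" for x by (simp add: g_def)
  \<comment> \<open>Positive and negative jumps, the latter reflected.\<close>
  define P where "P = (\<lambda>x. indicator {0<..} x *\<^sub>R (measure \<sigma> {1} *\<^sub>R (lamperti_density \<alpha> (f 1) x *\<^sub>R F x)))"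
  define N where "N = (\<lambda>x. indicator {0<..} x *\<^sub>R (measure \<sigma> {-1} *\<^sub>R (lamperti_density \<alpha> (f (-1)) x *\<^sub>R F (-x))))"
  have P: "integrable lborel P"
    unfolding P_def set_integrable_def[symmetric] by (rule set_integrable_scaleR_right) (rule pos)
  have N: "integrable lborel N"
    unfolding N_def set_integrable_def[symmetric] by (rule set_integrable_scaleR_right) (rule neg)
  have N': "integrable lborel (\<lambda>x. N (-x))"
    using lborel_integrable_real_affine[OF N, of "-1" 0] by simp
  have "(LINT x:-{0}|lamperti_levy_measure \<alpha> f \<sigma>. F x) = (LINT x|density lborel (\<lambda>x. ennreal (g x)). indicator (-{0}) x *\<^sub>R F x)"
    by (simp add: lamperti_levy_measure_def set_lebesgue_integral_def g_def)
  also have "\<dots> = (LINT x|lborel. g x *\<^sub>R (indicator (-{0}) x *\<^sub>R F x))"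
    by (intro integral_density AE_I2 g_nonneg) measurable
  also have "\<dots> = (LINT x|lborel. P x + N (-x))"
    by (intro Bochner_Integration.integral_cong refl)
       (auto simp: P_def N_def g_def lamperti_density_def indicator_def)
  also have "\<dots> = (LINT x|lborel. P x) + (LINT x|lborel. N (-x))"
    by (intro Bochner_Integration.integral_add P N')
  also have "(LINT x|lborel. N (-x)) = (LINT x|lborel. N x)"
    using lborel_integral_real_affine[of "-1" N 0] by simp
  finally show ?thesis
    unfolding P_def N_def set_lebesgue_integral_def[symmetric] by (simp only: set_integral_scaleR_right)
qed

text \<open>
  For \<open>\<alpha> < 1\<close> the drift contains the mean of the small jumps, which \<open>small_jumps_less_1\<close>
  expresses through \<open>lamperti_const\<close> and \<open>1 / (1 - \<alpha>) = - 1 / (\<alpha> - 1)\<close>. The small jumps are those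
  with \<open>\<bar>x\<bar> \<le> 1\<close> in the drift but those with \<open>\<bar>x\<bar> < 1\<close> there, hence the argument almost everywhere.
\<close>
lemma lamperti_theta_neq_1:
  assumes \<alpha>: "\<alpha> < 2" "\<alpha> \<noteq> 1" and f: "max (f 1) (f (-1)) < \<alpha> + 1"
  shows "lamperti_theta \<alpha> f \<sigma> \<theta> = \<theta> - (measure \<sigma> {1} * lamperti_const \<alpha> (f 1)
     - measure \<sigma> {-1} * lamperti_const \<alpha> (f (-1)) + (measure \<sigma> {1} - measure \<sigma> {-1}) / (\<alpha> - 1))"
proof (cases "\<alpha> < 1")
  case True
  define m where "m = (\<lambda>\<kappa>. LINT x:{0<..}|lborel. lamperti_density \<alpha> \<kappa> x * (x * indicator {..<1} x))"
  have "1 / (1 - \<alpha>) = - (1 / (\<alpha> - 1))" using True by (simp add: field_simps)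
  then have m: "m \<kappa> = - (1 / (\<alpha> - 1)) - lamperti_const \<alpha> \<kappa>" if "\<kappa> < \<alpha> + 1" for \<kappa>
    unfolding m_def using small_jumps_less_1(2)[OF True that] by simp
  let ?F = "\<lambda>x::real. indicator {x. \<bar>x\<bar> \<le> 1} x * x"
  have AE: "AE x in lborel. x \<noteq> (1::real)" by (rule AE_lborel_singleton)
  have half: "set_integrable lborel {0<..} (\<lambda>x. lamperti_density \<alpha> \<kappa> x *\<^sub>R ?F x)"
     "(LINT x:{0<..}|lborel. lamperti_density \<alpha> \<kappa> x *\<^sub>R ?F x) = m \<kappa>" if "\<kappa> < \<alpha> + 1" for \<kappa>
  proof -
    have meas: "(\<lambda>x. indicat_real {0<..} x *\<^sub>R (lamperti_density \<alpha> \<kappa> x * (x * indicator {..<1} x))) \<in> borel_measurable lborel"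
       "(\<lambda>x. indicat_real {0<..} x *\<^sub>R (lamperti_density \<alpha> \<kappa> x *\<^sub>R ?F x)) \<in> borel_measurable lborel"
      by measurable
    have ae: "AE x in lborel. indicat_real {0<..} x *\<^sub>R (lamperti_density \<alpha> \<kappa> x *\<^sub>R ?F x) =
        indicat_real {0<..} x *\<^sub>R (lamperti_density \<alpha> \<kappa> x * (x * indicator {..<1} x))"
      using AE by eventually_elim (auto simp: indicator_def)
    show "set_integrable lborel {0<..} (\<lambda>x. lamperti_density \<alpha> \<kappa> x *\<^sub>R ?F x)"
      using small_jumps_less_1(1)[OF True that] integrable_cong_AE[OF meas(2) meas(1) ae]
      unfolding set_integrable_def by simp
    show "(LINT x:{0<..}|lborel. lamperti_density \<alpha> \<kappa> x *\<^sub>R ?F x) = m \<kappa>"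
      unfolding m_def set_lebesgue_integral_def by (rule integral_cong_AE[OF meas(2) meas(1) ae])
  qed
  have neg: "(\<lambda>x. lamperti_density \<alpha> \<kappa> x *\<^sub>R ?F (-x)) = (\<lambda>x. (-1) * (lamperti_density \<alpha> \<kappa> x *\<^sub>R ?F x))" for \<kappa>
    by (auto simp: fun_eq_iff indicator_def)
  have "(LINT x : {x. \<bar>x\<bar> \<le> 1} | lamperti_levy_measure \<alpha> f \<sigma>. x) = (LINT x : -{0} | lamperti_levy_measure \<alpha> f \<sigma>. ?F x)"
    unfolding set_lebesgue_integral_def
    by (intro Bochner_Integration.integral_cong) (auto simp: indicator_def)
  also have "\<dots> = measure \<sigma> {1} *\<^sub>R (LINT x:{0<..}|lborel. lamperti_density \<alpha> (f 1) x *\<^sub>R ?F x) +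
     measure \<sigma> {-1} *\<^sub>R (LINT x:{0<..}|lborel. lamperti_density \<alpha> (f (-1)) x *\<^sub>R ?F (-x))"
  proof (rule lamperti_levy_measure_integral)
    show "set_integrable lborel {0<..} (\<lambda>x. lamperti_density \<alpha> (f 1) x *\<^sub>R ?F x)"
      using f by (intro half(1)) simp
    show "set_integrable lborel {0<..} (\<lambda>x. lamperti_density \<alpha> (f (-1)) x *\<^sub>R ?F (-x))"
      unfolding neg using f by (intro set_integrable_mult_right half(1)) simp
  qed measurable
  also have "\<dots> = measure \<sigma> {1} * m (f 1) - measure \<sigma> {-1} * m (f (-1))"
    unfolding neg set_integral_mult_right using f by (simp add: half(2) del: real_scaleR_def) simp
  finally show ?thesis using f True
    by (simp add: lamperti_theta_def lamperti_drift_def m Let_def algebra_simps diff_divide_distrib)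
next
  case False
  then show ?thesis using \<alpha> by (simp add: lamperti_theta_def Let_def)
qed

lemma levy_khintchine_exponent_lamperti:
  fixes y :: real
  assumes \<alpha>: "\<alpha> < 2" and f: "max (f 1) (f (-1)) < \<alpha> + 1"
  defines "r \<equiv> \<lambda>\<kappa>. complex_of_real (\<alpha> + 1 - \<kappa>)"
  shows "levy_khintchine_exponent \<theta> 0 (lamperti_levy_measure \<alpha> f \<sigma>) y = \<i> * y * \<theta>
    + measure \<sigma> {1} * (compensated_integral \<alpha> (r (f 1)) (r (f 1) - \<i> * y) - \<i> * y * lamperti_const \<alpha> (f 1))
    + measure \<sigma> {-1} * (compensated_integral \<alpha> (r (f (-1))) (r (f (-1)) + \<i> * y) + \<i> * y * lamperti_const \<alpha> (f (-1)))"
proof -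
  define F where "F = (\<lambda>y x::real. 1 - iexp (y * x) + \<i> * y * x * indicator {x. \<bar>x\<bar> < 1} x)"
  have neg: "F y (-x) = F (-y) x" for x by (simp add: F_def indicator_def)
  have *: "f 1 < \<alpha> + 1" "f (-1) < \<alpha> + 1" using f by auto
  have "(CLINT x:-{0}|lamperti_levy_measure \<alpha> f \<sigma>. F y x) =
     measure \<sigma> {1} *\<^sub>R (CLINT x:{0<..}|lborel. lamperti_density \<alpha> (f 1) x *\<^sub>R F y x) +
     measure \<sigma> {-1} *\<^sub>R (CLINT x:{0<..}|lborel. lamperti_density \<alpha> (f (-1)) x *\<^sub>R F y (-x))"
  proof (rule lamperti_levy_measure_integral)
    show "F y \<in> borel_measurable borel" unfolding F_def by measurable
    show "set_integrable lborel {0<..} (\<lambda>x. lamperti_density \<alpha> (f 1) x *\<^sub>R F y x)"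
      unfolding F_def by (rule half_line_exponent(1)[OF \<alpha> *(1)])
    show "set_integrable lborel {0<..} (\<lambda>x. lamperti_density \<alpha> (f (-1)) x *\<^sub>R F y (-x))"
      unfolding neg unfolding F_def by (rule half_line_exponent(1)[OF \<alpha> *(2)])
  qed
  then show ?thesis
    unfolding neg unfolding F_def half_line_exponent(2)[OF \<alpha> *(1)] half_line_exponent(2)[OF \<alpha> *(2)]
    by (simp add: levy_khintchine_exponent_def r_def scaleR_conv_of_real)
qed

text \<open>
  If \<open>exp(t z) = 1\<close> for all \<open>t \<ge> 0\<close>, then \<open>t = 1 / \<bar>z\<bar>\<close> would give a period of \<open>exp\<close> of
  modulus \<open>1 < 2 \<pi>\<close>.
\<close>
lemma characteristic_exponent_unique:
  assumes "characteristic_exponent M X \<Psi>" "characteristic_exponent M X \<Phi>"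
  shows "\<Psi> = \<Phi>"
proof
  fix y
  have "exp (- (complex_of_real t * \<Psi> y)) = exp (- (complex_of_real t * \<Phi> y))" if "t \<ge> 0" for t
    using assms that unfolding characteristic_exponent_def by metis
  then have *: "exp (of_real t * (\<Psi> y - \<Phi> y)) = 1" if "t \<ge> 0" for t
    using that by (simp add: algebra_simps exp_diff exp_minus)
  define z where "z = \<Psi> y - \<Phi> y"
  have "z = 0"
  proof (rule ccontr)
    assume "z \<noteq> 0"
    define w where "w = of_real (1 / norm z) * z"
    have norm_w: "norm w = 1" using \<open>z \<noteq> 0\<close> by (simp add: w_def norm_divide)
    have "exp w = 1" using *[of "1 / norm z"] by (simp add: w_def z_def)
    then obtain n :: int where n: "Re w = 0" "Im w = of_int (2 * n) * pi" by (auto simp: exp_eq_1)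
    then have "\<bar>Im w\<bar> = 1" using norm_w by (simp add: cmod_def)
    then have "\<bar>real_of_int (2 * n)\<bar> * pi = 1" using n by (simp add: abs_mult)
    moreover from this have "1 \<le> \<bar>2 * n\<bar>" by (cases "n = 0") auto
    then have "1 * pi \<le> \<bar>real_of_int (2 * n)\<bar> * pi" by (intro mult_right_mono) (linarith, simp)
    ultimately show False using pi_gt3 by simp
  qed
  then show "\<Psi> y = \<Phi> y" by (simp add: z_def)
qed

theorem theorem1:
  fixes M :: "'a measure" and X :: "real \<Rightarrow> 'a \<Rightarrow> real"
    and \<alpha> \<theta> \<beta> \<rho> c\<^sub>p c\<^sub>m :: real and f :: "real \<Rightarrow> real" and \<sigma> :: "real measure"
    and \<Psi> :: "real \<Rightarrow> complex"
  assumes alpha: "0 < \<alpha>" "\<alpha> < 2"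
    and sigma: "sets \<sigma> = Pow {-1, 1}" "finite_measure \<sigma>" "emeasure \<sigma> {-1, 1} \<noteq> 0"
    and f: "max (f 1) (f (-1)) < \<alpha> + 1"
    and X: "lamperti_stable M X \<alpha> f \<sigma> \<theta>"
    and Psi: "characteristic_exponent M X \<Psi>"
    and beta: "\<beta> = f 1" and rho: "\<rho> = f (-1)"
    and cp: "c\<^sub>p = measure \<sigma> {1}" and cm: "c\<^sub>m = measure \<sigma> {-1}"
  shows "(\<alpha> \<in> {0<..<1} \<union> {1<..<2} \<longrightarrow>
           (\<forall>l::real. \<Psi> l = \<i> * l * lamperti_theta \<alpha> f \<sigma> \<theta>
              - c\<^sub>p * Gamma (- \<alpha>) *
                  (pochhammer_real (- \<i> * l + 1 - \<beta>) \<alpha> - pochhammer_real (1 - \<beta>) \<alpha>)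
              - c\<^sub>m * Gamma (- \<alpha>) *
                  (pochhammer_real (\<i> * l + 1 - \<rho>) \<alpha> - pochhammer_real (1 - \<rho>) \<alpha>))) \<and>
         (\<alpha> = 1 \<longrightarrow>
           (\<forall>l::real. \<Psi> l = \<i> * l * lamperti_theta \<alpha> f \<sigma> \<theta>
              - c\<^sub>p * ((- \<i> * l + 1 - \<beta>) * Digamma (- \<i> * l + 2 - \<beta>)
                        - (1 - \<beta>) * Digamma (2 - \<beta>))
              - c\<^sub>m * ((\<i> * l + 1 - \<rho>) * Digamma (\<i> * l + 2 - \<rho>)
                        - (1 - \<rho>) * Digamma (2 - \<rho>))))"
proof -
  define a b where "a = lamperti_const \<alpha> \<beta>" and "b = lamperti_const \<alpha> \<rho>"
  define r where "r = (\<lambda>\<kappa>. complex_of_real (\<alpha> + 1 - \<kappa>))"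
  have Psi_eq: "\<Psi> l = \<i> * l * \<theta>
      + c\<^sub>p * (compensated_integral \<alpha> (r \<beta>) (r \<beta> - \<i> * l) - \<i> * l * a)
      + c\<^sub>m * (compensated_integral \<alpha> (r \<rho>) (r \<rho> + \<i> * l) + \<i> * l * b)" for l :: real
  proof -
    have "\<Psi> = levy_khintchine_exponent \<theta> 0 (lamperti_levy_measure \<alpha> f \<sigma>)"
      using X Psi unfolding lamperti_stable_def by (blast intro: characteristic_exponent_unique)
    then show ?thesis
      using levy_khintchine_exponent_lamperti[OF alpha(2) f, of \<theta> \<sigma> l]
      by (simp add: beta rho cp cm a_def b_def r_def)
  qed
  have r: "Re (r \<beta>) > 0" "Re (r \<rho>) > 0" "Re (r \<beta> - \<i> * of_real l) > 0" "Re (r \<rho> + \<i> * of_real l) > 0" for l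
    using f by (simp_all add: r_def beta rho)
  show ?thesis
  proof (intro conjI impI allI)
    fix l :: real assume "\<alpha> \<in> {0<..<1} \<union> {1<..<2}"
    then have neq: "\<alpha> \<noteq> 1" by auto
    have theta: "lamperti_theta \<alpha> f \<sigma> \<theta> = \<theta> - (c\<^sub>p * a - c\<^sub>m * b + (c\<^sub>p - c\<^sub>m) / (\<alpha> - 1))"
      using lamperti_theta_neq_1[OF alpha(2) neq f, of \<sigma> \<theta>] by (simp add: cp cm a_def b_def beta rho)
    have p: "pochhammer_real (- \<i> * l + 1 - \<beta>) \<alpha> = Gamma (r \<beta> - \<i> * l) * rGamma (r \<beta> - \<i> * l - \<alpha>)"
      "pochhammer_real (1 - \<beta>) \<alpha> = Gamma (r \<beta>) * rGamma (r \<beta> - \<alpha>)"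
      "pochhammer_real (\<i> * l + 1 - \<rho>) \<alpha> = Gamma (r \<rho> + \<i> * l) * rGamma (r \<rho> + \<i> * l - \<alpha>)"
      "pochhammer_real (1 - \<rho>) \<alpha> = Gamma (r \<rho>) * rGamma (r \<rho> - \<alpha>)"
      by (simp_all add: pochhammer_real_def r_def algebra_simps)
    show "\<Psi> l = \<i> * l * lamperti_theta \<alpha> f \<sigma> \<theta>
              - c\<^sub>p * Gamma (- \<alpha>) *
                  (pochhammer_real (- \<i> * l + 1 - \<beta>) \<alpha> - pochhammer_real (1 - \<beta>) \<alpha>)
              - c\<^sub>m * Gamma (- \<alpha>) *
                  (pochhammer_real (\<i> * l + 1 - \<rho>) \<alpha> - pochhammer_real (1 - \<rho>) \<alpha>)"
      unfolding p theta Psi_eq 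
        compensated_integral_eq_Gamma[OF alpha(2) r(1) r(3) alpha(1) neq]
        compensated_integral_eq_Gamma[OF alpha(2) r(2) r(4) alpha(1) neq]
      by (simp add: Gamma_complex_of_real[symmetric] algebra_simps add_divide_distrib diff_divide_distrib)
  next
    fix l :: real assume eq: "\<alpha> = 1"
    have theta: "lamperti_theta \<alpha> f \<sigma> \<theta> = \<theta> - (c\<^sub>p * a - c\<^sub>m * b + (c\<^sub>p - c\<^sub>m) * (1 - euler_mascheroni))"
      by (simp add: lamperti_theta_def Let_def eq a_def b_def cp cm beta rho)
    have p: "- \<i> * l + 2 - \<beta> = r \<beta> - \<i> * l" "\<i> * l + 2 - \<rho> = r \<rho> + \<i> * l"
      "- \<i> * l + 1 - \<beta> = r \<beta> - \<i> * l - 1" "\<i> * l + 1 - \<rho> = r \<rho> + \<i> * l - 1"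
      "complex_of_real (1 - \<beta>) = r \<beta> - 1" "complex_of_real (1 - \<rho>) = r \<rho> - 1"
      by (simp_all add: r_def eq)
    have d: "complex_of_real (Digamma (2 - \<beta>)) = Digamma (r \<beta>)"
      "complex_of_real (Digamma (2 - \<rho>)) = Digamma (r \<rho>)"
      using f by (simp_all add: r_def eq beta rho flip: Polygamma_of_real)
    show "\<Psi> l = \<i> * l * lamperti_theta \<alpha> f \<sigma> \<theta>
              - c\<^sub>p * ((- \<i> * l + 1 - \<beta>) * Digamma (- \<i> * l + 2 - \<beta>)
                        - (1 - \<beta>) * Digamma (2 - \<beta>))
              - c\<^sub>m * ((\<i> * l + 1 - \<rho>) * Digamma (\<i> * l + 2 - \<rho>)
                        - (1 - \<rho>) * Digamma (2 - \<rho>))"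
      unfolding of_real_mult p d theta Psi_eq
        compensated_integral_eq_Digamma[OF alpha(2) r(1) r(3) eq]
        compensated_integral_eq_Digamma[OF alpha(2) r(2) r(4) eq]
      by (simp add: algebra_simps)
  qed
qed

end
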